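(* Let $(\mathfrak{A},\mathsf{L})$ be a quantum compact metric space where $\mathsf{L}$ is lower semi-continuous. If $\Xi$ is a set of lower semi-continuous Lip-norms on $\mathfrak{A}$ for which there exists $C>0$ such that, for all $\mathsf{Lip}\in\Xi$, we have $\mathsf{L}\leq C\,\mathsf{Lip}$, then $\Xi$ is totally bounded for $\mathrm{Haus}^\circ_{\mathfrak{A}}$. Therefore, when moreover there is an admissible function $F$ such that $(\mathfrak{A},\mathsf{Lip})$ is an $F$-quasi-Leibniz quantum compact metric space for every $\mathsf{Lip}\in\Xi$, the class $\{(\mathfrak{A},\mathsf{Lip}):\mathsf{Lip}\in\Xi\}$ is also totally bounded for the quantum propinquity $\mathsf{\Lambda}_F$.
   Context: For a unital C*-algebra $\mathfrak{A}$ with unit $1_{\mathfrak{A}}$, $\mathfrak{sa}(\mathfrak{A})$ is the space of self-adjoint elements and $\mathscr{S}(\mathfrak{A})$ the state space. A quantum compact metric space $(\mathfrak{A},\mathsf{L})$ is a unital C*-algebra $\mathfrak{A}$ with a seminorm $\mathsf{L}$ (called a Lip-norm on $\mathfrak{A}$) defined on a dense subspace $\mathrm{dom}(\mathsf{L})$ of $\mathfrak{sa}(\mathfrak{A})$ such that $\{a\in\mathrm{dom}(\mathsf{L}):\mathsf{L}(a)=0\}=\mathbb{R}1_{\mathfrak{A}}$ and the Monge-Kantorovich metric $\mathsf{mk}_{\mathsf{L}}(\varphi,\psi)=\sup\{|\varphi(a)-\psi(a)| : a\in\mathrm{dom}(\mathsf{L}),\ \mathsf{L}(a)\leq 1\}$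 metrizes the weak* topology on $\mathscr{S}(\mathfrak{A})$. A Lip-norm takes the value $\infty$ outside its domain; inequalities between Lip-norms are between $[0,\infty]$-valued functions on $\mathfrak{sa}(\mathfrak{A})$. $\mathsf{L}$ is lower semi-continuous when $\{a\in\mathfrak{sa}(\mathfrak{A}):\mathsf{L}(a)\leq 1\}$ is norm closed. For a metric $d$, $\mathrm{Haus}_d$ denotes the Hausdorff distance. For lower semi-continuous Lip-norms $\mathsf{L},\mathsf{L}'$ on $\mathfrak{A}$, $\mathrm{Haus}^\circ_{\mathfrak{A}}(\mathsf{L},\mathsf{L}')$ is the Hausdorff distance, for the norm $\|\cdot\|_{\mathfrak{A}}$, between $\{a\in\mathfrak{sa}(\mathfrak{A}):\mathsf{L}(a)\leq1\}$ and $\{a\in\mathfrak{sa}(\mathfrak{A}):\mathsf{L}'(a)\leq1\}$. A function $F:[0,\infty)^4\to[0,\infty)$ is admissible when it is increasing for the product order and $F(x,y,l_x,l_y)\geq x l_y+y l_x$ for all $x,y,l_x,l_y\geq0$. An $F$-quasi-Leibniz quantum compact metric space is a quantum compact metric space $(\mathfrak{A},\mathsf{L})$, with $\mathsf{L}$ lower semi-continuous, such that $\max\{\mathsf{L}(\frac{ab+ba}{2}),\mathsf{L}(\frac{ab-ba}{2i})\}\leq F(\|a\|_{\mathfrak{A}},\|b\|_{\mathfrak{A}},\mathsf{L}(a),\mathsf{L}(b))$ for all $a,b\in\mathrm{dom}(\mathsf{L})$. A bridge $\gamma=(\mathfrak{D},\omega,\pi_{\mathfrak{A}},\pi_{\mathfrak{B}})$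 from $\mathfrak{A}$ to $\mathfrak{B}$ consists of a unital C*-algebra $\mathfrak{D}$, unital *-monomorphisms $\pi_{\mathfrak{A}}:\mathfrak{A}\to\mathfrak{D}$, $\pi_{\mathfrak{B}}:\mathfrak{B}\to\mathfrak{D}$, and $\omega\in\mathfrak{D}$ such that $\mathscr{S}_1(\mathfrak{D}|\omega)=\{\varphi\in\mathscr{S}(\mathfrak{D}):\varphi(\omega d)=\varphi(d\omega)=\varphi(d)\ \forall d\in\mathfrak{D}\}$ is nonempty. Its reach is the Hausdorff distance for $\|\cdot\|_{\mathfrak{D}}$ between $\{\pi_{\mathfrak{A}}(a)\omega:a\in\mathfrak{sa}(\mathfrak{A}),\mathsf{L}_{\mathfrak{A}}(a)\leq1\}$ and $\{\omega\pi_{\mathfrak{B}}(b):b\in\mathfrak{sa}(\mathfrak{B}),\mathsf{L}_{\mathfrak{B}}(b)\leq1\}$; its height is the maximum of $\mathrm{Haus}_{\mathsf{mk}_{\mathsf{L}_{\mathfrak{A}}}}(\mathscr{S}(\mathfrak{A}),\{\varphi\circ\pi_{\mathfrak{A}}:\varphi\in\mathscr{S}_1(\mathfrak{D}|\omega)\})$ and $\mathrm{Haus}_{\mathsf{mk}_{\mathsf{L}_{\mathfrak{B}}}}(\mathscr{S}(\mathfrak{B}),\{\varphi\circ\pi_{\mathfrak{B}}:\varphi\in\mathscr{S}_1(\mathfrak{D}|\omega)\})$; its length is the maximum of its reach and height. The quantum propinquity $\mathsf{\Lambda}_F$ is the largest $[0,\infty)$-valued function on pairs of $F$-quasi-Leibniz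 quantum compact metric spaces which is symmetric, satisfies the triangle inequality, and satisfies $\mathsf{\Lambda}_F((\mathfrak{A},\mathsf{L}_{\mathfrak{A}}),(\mathfrak{B},\mathsf{L}_{\mathfrak{B}}))\leq$ length of $\gamma$ for every bridge $\gamma$ from $\mathfrak{A}$ to $\mathfrak{B}$. *)

theory Defs
  imports
    "HOL-Analysis.Analysis"
    "HOL-Algebra.Module"
    "HOL-Algebra.Algebraic_Closure_Type"
begin

section \<open>Unital C*-algebras\<close>

text \<open>
  C*-algebras are structures on carrier sets, not a type class, because the quantum propinquity
  quantifies over algebras. The scalars are the library's ring structure on the type
  \<^typ>\<open>complex\<close>.
\<close>

record 'a cstar = "(complex, 'a) module" +
  adj :: "'a \<Rightarrow> 'a"
  nrm :: "'a \<Rightarrow> real"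

text \<open>
  The locale \<^locale>\<open>Metric_space\<close> demands symmetry and nonnegativity of the distance on the whole
  type, hence the default value off the carrier.
\<close>

definition cstar_dist :: "'a cstar \<Rightarrow> 'a \<Rightarrow> 'a \<Rightarrow> real" where
  "cstar_dist A a b =
     (if a \<in> carrier A \<and> b \<in> carrier A then nrm A (a \<ominus>\<^bsub>A\<^esub> b) else 0)"

locale unital_cstar_algebra =
  Module.module "ring_of_type_algebra :: complex ring" A + ring A
  for A :: "'a cstar" (structure) +
  assumes one_neq_zero: "\<one> \<noteq> \<zero>"
    and smult_mult_left:
      "\<lbrakk>a \<in> carrier A; b \<in> carrier A\<rbrakk> \<Longrightarrow> (c \<odot> a) \<otimes> b = c \<odot> (a \<otimes> b)"
    and smult_mult_right:
      "\<lbrakk>a \<in> carrier A; b \<in> carrier A\<rbrakk> \<Longrightarrow> a \<otimes> (c \<odot> b) = c \<odot> (a \<otimes> b)"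
    and adj_closed: "a \<in> carrier A \<Longrightarrow> adj A a \<in> carrier A"
    and adj_adj: "a \<in> carrier A \<Longrightarrow> adj A (adj A a) = a"
    and adj_add:
      "\<lbrakk>a \<in> carrier A; b \<in> carrier A\<rbrakk> \<Longrightarrow> adj A (a \<oplus> b) = adj A a \<oplus> adj A b"
    and adj_smult: "a \<in> carrier A \<Longrightarrow> adj A (c \<odot> a) = cnj c \<odot> adj A a"
    and adj_mult:
      "\<lbrakk>a \<in> carrier A; b \<in> carrier A\<rbrakk> \<Longrightarrow> adj A (a \<otimes> b) = adj A b \<otimes> adj A a"
    and nrm_eq_0: "a \<in> carrier A \<Longrightarrow> nrm A a = 0 \<longleftrightarrow> a = \<zero>"
    and nrm_add:
      "\<lbrakk>a \<in> carrier A; b \<in> carrier A\<rbrakk> \<Longrightarrow> nrm A (a \<oplus> b) \<le> nrm A a + nrm A b"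
    and nrm_smult: "a \<in> carrier A \<Longrightarrow> nrm A (c \<odot> a) = cmod c * nrm A a"
    and nrm_mult:
      "\<lbrakk>a \<in> carrier A; b \<in> carrier A\<rbrakk> \<Longrightarrow> nrm A (a \<otimes> b) \<le> nrm A a * nrm A b"
    and nrm_cstar: "a \<in> carrier A \<Longrightarrow> nrm A (adj A a \<otimes> a) = (nrm A a)\<^sup>2"
    and complete: "Metric_space.mcomplete (carrier A) (cstar_dist A)"

definition sa :: "'a cstar \<Rightarrow> 'a set" where
  "sa A = {a \<in> carrier A. adj A a = a}"

text \<open>
  States are taken to be \<^const>\<open>extensional\<close>, so that equality of states is equality on the
  algebra and the weak* topology is a subspace topology of a product topology.
\<close>

definition states :: "'a cstar \<Rightarrow> ('a \<Rightarrow> complex) set" where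
  "states A = {\<phi> \<in> extensional (carrier A).
     (\<forall>a\<in>carrier A. \<forall>b\<in>carrier A. \<phi> (a \<oplus>\<^bsub>A\<^esub> b) = \<phi> a + \<phi> b) \<and>
     (\<forall>c. \<forall>a\<in>carrier A. \<phi> (c \<odot>\<^bsub>A\<^esub> a) = c * \<phi> a) \<and>
     (\<forall>a\<in>carrier A. \<phi> (adj A a \<otimes>\<^bsub>A\<^esub> a) \<in> \<real>\<^sub>\<ge>\<^sub>0) \<and>
     \<phi> \<one>\<^bsub>A\<^esub> = 1}"

definition weak_star_topology :: "'a cstar \<Rightarrow> ('a \<Rightarrow> complex) topology" where
  "weak_star_topology A =
     subtopology (product_topology (\<lambda>_. euclidean) (carrier A)) (states A)"

definition unital_star_mono :: "'a cstar \<Rightarrow> 'b cstar \<Rightarrow> ('a \<Rightarrow> 'b) \<Rightarrow> bool" where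
  "unital_star_mono A D \<pi> \<longleftrightarrow>
     \<pi> \<in> ring_hom A D \<and>
     (\<forall>c. \<forall>a\<in>carrier A. \<pi> (c \<odot>\<^bsub>A\<^esub> a) = c \<odot>\<^bsub>D\<^esub> \<pi> a) \<and>
     (\<forall>a\<in>carrier A. \<pi> (adj A a) = adj D (\<pi> a)) \<and>
     inj_on \<pi> (carrier A)"


section \<open>Quantum compact metric spaces\<close>

text \<open>
  Lip-norms are \<^typ>\<open>ennreal\<close>-valued; only their values on self-adjoint elements matter.
\<close>

definition lip_dom :: "'a cstar \<Rightarrow> ('a \<Rightarrow> ennreal) \<Rightarrow> 'a set" where
  "lip_dom A L = {a \<in> sa A. L a < \<infinity>}"

definition lip_ball :: "'a cstar \<Rightarrow> ('a \<Rightarrow> ennreal) \<Rightarrow> 'a set" where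
  "lip_ball A L = {a \<in> sa A. L a \<le> 1}"

definition mk_dist ::
  "'a cstar \<Rightarrow> ('a \<Rightarrow> ennreal) \<Rightarrow> ('a \<Rightarrow> complex) \<Rightarrow> ('a \<Rightarrow> complex) \<Rightarrow> ennreal" where
  "mk_dist A L \<phi> \<psi> = (SUP a\<in>lip_ball A L. ennreal (cmod (\<phi> a - \<psi> a)))"

definition metrizes_weak_star :: "'a cstar \<Rightarrow> ('a \<Rightarrow> ennreal) \<Rightarrow> bool" where
  "metrizes_weak_star A L \<longleftrightarrow>
     (\<forall>\<phi>\<in>states A. \<forall>\<psi>\<in>states A. mk_dist A L \<phi> \<psi> < \<infinity>) \<and>
     Metric_space (states A) (\<lambda>\<phi> \<psi>. enn2real (mk_dist A L \<phi> \<psi>)) \<and>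
     Metric_space.mtopology (states A) (\<lambda>\<phi> \<psi>. enn2real (mk_dist A L \<phi> \<psi>)) =
       weak_star_topology A"

text \<open>
  The first three conjuncts after \<open>unital_cstar_algebra A\<close> say that \<open>L\<close> is a seminorm whose domain
  is a real subspace of \<^term>\<open>sa A\<close>.
\<close>

definition qcms :: "'a cstar \<Rightarrow> ('a \<Rightarrow> ennreal) \<Rightarrow> bool" where
  "qcms A L \<longleftrightarrow>
     unital_cstar_algebra A \<and>
     \<zero>\<^bsub>A\<^esub> \<in> lip_dom A L \<and>
     (\<forall>a\<in>lip_dom A L. \<forall>b\<in>lip_dom A L.
        a \<oplus>\<^bsub>A\<^esub> b \<in> lip_dom A L \<and> L (a \<oplus>\<^bsub>A\<^esub> b) \<le> L a + L b) \<and>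
     (\<forall>t::real. \<forall>a\<in>lip_dom A L.
        complex_of_real t \<odot>\<^bsub>A\<^esub> a \<in> lip_dom A L \<and>
        L (complex_of_real t \<odot>\<^bsub>A\<^esub> a) = ennreal \<bar>t\<bar> * L a) \<and>
     (\<forall>a\<in>sa A. \<forall>\<epsilon>>0. \<exists>b\<in>lip_dom A L. cstar_dist A a b < \<epsilon>) \<and>
     {a \<in> lip_dom A L. L a = 0} = range (\<lambda>t::real. complex_of_real t \<odot>\<^bsub>A\<^esub> \<one>\<^bsub>A\<^esub>) \<and>
     metrizes_weak_star A L"

definition lower_semicontinuous_lip :: "'a cstar \<Rightarrow> ('a \<Rightarrow> ennreal) \<Rightarrow> bool" where
  "lower_semicontinuous_lip A L \<longleftrightarrow>
     closedin (Metric_space.mtopology (carrier A) (cstar_dist A)) (lip_ball A L)"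

definition hausdorff :: "('b \<Rightarrow> 'b \<Rightarrow> ennreal) \<Rightarrow> 'b set \<Rightarrow> 'b set \<Rightarrow> ennreal" where
  "hausdorff d S T = max (SUP s\<in>S. INF t\<in>T. d s t) (SUP t\<in>T. INF s\<in>S. d s t)"

definition haus_nrm :: "'a cstar \<Rightarrow> 'a set \<Rightarrow> 'a set \<Rightarrow> ennreal" where
  "haus_nrm A = hausdorff (\<lambda>a b. ennreal (cstar_dist A a b))"

definition haus_lip :: "'a cstar \<Rightarrow> ('a \<Rightarrow> ennreal) \<Rightarrow> ('a \<Rightarrow> ennreal) \<Rightarrow> ennreal" where
  "haus_lip A L L' = haus_nrm A (lip_ball A L) (lip_ball A L')"

text \<open>
  Total boundedness for a \<^typ>\<open>ennreal\<close>-valued distance that may vanish off the diagonal,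
  as the propinquity does; \<^locale>\<open>Metric_space\<close> excludes such distances.
\<close>

definition totally_bounded_for :: "('b \<Rightarrow> 'b \<Rightarrow> ennreal) \<Rightarrow> 'b set \<Rightarrow> bool" where
  "totally_bounded_for d S \<longleftrightarrow>
     (\<forall>\<epsilon>>0. \<exists>K. finite K \<and> K \<subseteq> S \<and> (\<forall>x\<in>S. \<exists>y\<in>K. d x y < \<epsilon>))"


section \<open>Quasi-Leibniz spaces, bridges and the quantum propinquity\<close>

definition admissible :: "(real \<Rightarrow> real \<Rightarrow> real \<Rightarrow> real \<Rightarrow> real) \<Rightarrow> bool" where
  "admissible F \<longleftrightarrow>
     (\<forall>x\<ge>0. \<forall>y\<ge>0. \<forall>l\<ge>0. \<forall>m\<ge>0. F x y l m \<ge> 0) \<and>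
     (\<forall>x x' y y' l l' m m'. 0 \<le> x \<and> x \<le> x' \<and> 0 \<le> y \<and> y \<le> y' \<and>
        0 \<le> l \<and> l \<le> l' \<and> 0 \<le> m \<and> m \<le> m' \<longrightarrow> F x y l m \<le> F x' y' l' m') \<and>
     (\<forall>x\<ge>0. \<forall>y\<ge>0. \<forall>l\<ge>0. \<forall>m\<ge>0. F x y l m \<ge> x * m + y * l)"

definition quasi_leibniz ::
  "(real \<Rightarrow> real \<Rightarrow> real \<Rightarrow> real \<Rightarrow> real) \<Rightarrow> 'a cstar \<Rightarrow> ('a \<Rightarrow> ennreal) \<Rightarrow> bool" where
  "quasi_leibniz F A L \<longleftrightarrow>
     qcms A L \<and> lower_semicontinuous_lip A L \<and>
     (\<forall>a\<in>lip_dom A L. \<forall>b\<in>lip_dom A L.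
        max (L ((1 / 2) \<odot>\<^bsub>A\<^esub> (a \<otimes>\<^bsub>A\<^esub> b \<oplus>\<^bsub>A\<^esub> b \<otimes>\<^bsub>A\<^esub> a)))
            (L ((1 / (2 * \<i>)) \<odot>\<^bsub>A\<^esub> (a \<otimes>\<^bsub>A\<^esub> b \<ominus>\<^bsub>A\<^esub> b \<otimes>\<^bsub>A\<^esub> a)))
          \<le> ennreal (F (nrm A a) (nrm A b) (enn2real (L a)) (enn2real (L b))))"

record 'a bridge =
  br_alg :: "'a cstar"
  br_pivot :: 'a
  br_left :: "'a \<Rightarrow> 'a"
  br_right :: "'a \<Rightarrow> 'a"

definition level_states :: "'a cstar \<Rightarrow> 'a \<Rightarrow> ('a \<Rightarrow> complex) set" where
  "level_states D \<omega> =
     {\<phi> \<in> states D. \<forall>d\<in>carrier D. \<phi> (\<omega> \<otimes>\<^bsub>D\<^esub> d) = \<phi> d \<and> \<phi> (d \<otimes>\<^bsub>D\<^esub> \<omega>) = \<phi> d}"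

definition is_bridge :: "'a cstar \<Rightarrow> 'a cstar \<Rightarrow> 'a bridge \<Rightarrow> bool" where
  "is_bridge A B \<gamma> \<longleftrightarrow>
     unital_cstar_algebra (br_alg \<gamma>) \<and>
     unital_star_mono A (br_alg \<gamma>) (br_left \<gamma>) \<and>
     unital_star_mono B (br_alg \<gamma>) (br_right \<gamma>) \<and>
     br_pivot \<gamma> \<in> carrier (br_alg \<gamma>) \<and>
     level_states (br_alg \<gamma>) (br_pivot \<gamma>) \<noteq> {}"

type_synonym 'a lip_pair = "'a cstar \<times> ('a \<Rightarrow> ennreal)"

definition bridge_reach :: "'a lip_pair \<Rightarrow> 'a lip_pair \<Rightarrow> 'a bridge \<Rightarrow> ennreal" where
  "bridge_reach S T \<gamma> =
     (let D = br_alg \<gamma>; \<omega> = br_pivot \<gamma> in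
        haus_nrm D
          ((\<lambda>a. br_left \<gamma> a \<otimes>\<^bsub>D\<^esub> \<omega>) ` lip_ball (fst S) (snd S))
          ((\<lambda>b. \<omega> \<otimes>\<^bsub>D\<^esub> br_right \<gamma> b) ` lip_ball (fst T) (snd T)))"

text \<open>
  \<open>compose (carrier A) \<phi> \<pi>\<close> is the composite of \<open>\<phi>\<close> and \<open>\<pi>\<close>, made extensional on the carrier
  of \<open>A\<close>.
\<close>

definition bridge_height :: "'a lip_pair \<Rightarrow> 'a lip_pair \<Rightarrow> 'a bridge \<Rightarrow> ennreal" where
  "bridge_height S T \<gamma> = max
     (hausdorff (mk_dist (fst S) (snd S)) (states (fst S))
        ((\<lambda>\<phi>. compose (carrier (fst S)) \<phi> (br_left \<gamma>)) `
           level_states (br_alg \<gamma>) (br_pivot \<gamma>)))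
     (hausdorff (mk_dist (fst T) (snd T)) (states (fst T))
        ((\<lambda>\<phi>. compose (carrier (fst T)) \<phi> (br_right \<gamma>)) `
           level_states (br_alg \<gamma>) (br_pivot \<gamma>)))"

definition bridge_length :: "'a lip_pair \<Rightarrow> 'a lip_pair \<Rightarrow> 'a bridge \<Rightarrow> ennreal" where
  "bridge_length S T \<gamma> = max (bridge_reach S T \<gamma>) (bridge_height S T \<gamma>)"

text \<open>
  All spaces and bridges over which the propinquity quantifies live on subsets of one type
  \<open>'a\<close>. This loses nothing: the carrier of a nonzero complex algebra has at least the cardinality
  of the continuum, so if \<open>'a\<close> carries one then every separable C*-algebra has a copy on a subset
  of \<open>'a\<close>. Quantum compact metric spaces are separable, and a bridge may be cut down, without
  changing its length, to the separable C*-algebra generated by its pivot and the two embedded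
  algebras.
\<close>

definition ql_spaces :: "(real \<Rightarrow> real \<Rightarrow> real \<Rightarrow> real \<Rightarrow> real) \<Rightarrow> 'a lip_pair set" where
  "ql_spaces F = {S. quasi_leibniz F (fst S) (snd S)}"

definition propinquity_candidates ::
  "(real \<Rightarrow> real \<Rightarrow> real \<Rightarrow> real \<Rightarrow> real) \<Rightarrow> ('a lip_pair \<Rightarrow> 'a lip_pair \<Rightarrow> real) set" where
  "propinquity_candidates F = {f.
     (\<forall>S\<in>ql_spaces F. \<forall>T\<in>ql_spaces F. 0 \<le> f S T \<and> f S T = f T S) \<and>
     (\<forall>S\<in>ql_spaces F. \<forall>T\<in>ql_spaces F. \<forall>U\<in>ql_spaces F. f S U \<le> f S T + f T U) \<and>
     (\<forall>S\<in>ql_spaces F. \<forall>T\<in>ql_spaces F. \<forall>\<gamma>. is_bridge (fst S) (fst T) \<gamma> \<longrightarrow>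
        ennreal (f S T) \<le> bridge_length S T \<gamma>)}"

text \<open>
  The largest candidate, as the pointwise supremum of all candidates. The supremum is taken in
  \<^typ>\<open>ennreal\<close>, so that the definition does not presuppose that a largest real-valued candidate
  exists; the lemma below identifies the two.
\<close>

definition quantum_propinquity ::
  "(real \<Rightarrow> real \<Rightarrow> real \<Rightarrow> real \<Rightarrow> real) \<Rightarrow> 'a lip_pair \<Rightarrow> 'a lip_pair \<Rightarrow> ennreal" where
  "quantum_propinquity F S T = (SUP f\<in>propinquity_candidates F. ennreal (f S T))"

lemma quantum_propinquity_eq_largest:
  assumes "g \<in> propinquity_candidates F"
    and "\<And>f S T. \<lbrakk>f \<in> propinquity_candidates F; S \<in> ql_spaces F; T \<in> ql_spaces F\<rbrakk>
           \<Longrightarrow> f S T \<le> g S T"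
    and "S \<in> ql_spaces F" "T \<in> ql_spaces F"
  shows "quantum_propinquity F S T = ennreal (g S T)"
  unfolding quantum_propinquity_def
  by (intro antisym SUP_least SUP_upper ennreal_leI assms)

end

theory Submission
  imports Defs
begin

text \<open>
  The states of a C*-algebra form a weak* compact set, and they control the norm of self-adjoint
  elements up to the factor \<open>3\<close>. As \<open>mk_dist A L\<close> metrizes the weak* topology, finitely many
  states are \<open>\<delta>\<close>-dense for it, and \<open>\<phi> \<mapsto> \<phi> a\<close> is \<open>C\<close>-Lipschitz for it whenever \<open>L a \<le> C\<close>; so rounding
  the values of these finitely many states sorts \<open>{a. L a \<le> C}\<close>, which contains all the unit balls
  of the Lip-norms in \<open>\<Xi>\<close>, into finitely many classes of small diameter modulo scalars. Since unit
  balls of Lip-norms are invariant under adding scalars, two Lip-norms whose balls meet the same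
  classes are close.

  The existence of states rests on an elementary treatment of the positive cone, without spectral
  theory: its elements are the self-adjoint \<open>h\<close> with \<open>\<parallel>s - h\<parallel> \<le> s\<close> for some \<open>s\<close>, and a square
  root of \<open>1 - h\<close> is \<open>1 - y\<close> for the limit \<open>y\<close> of the iterates of \<open>y \<mapsto> (h + y\<^sup>2) / 2\<close>. States come from maximal proper cones.
\<close>

section \<open>Norm limits\<close>

context unital_cstar_algebra
begin

text \<open>Metrization of the weak* topology speaks only about states, whereas the Hausdorff
  distance is measured in norm, so there must be enough states to recover the norm. The obstacle is
  the positivity clause in \<open>states\<close>: a functional built from a cone is nonnegative on
  what the cone contains, and is a state only if every \<open>adj A a \<otimes> a\<close> lies
  there. The ball condition behind \<open>pos\<close> makes sums, multiples and the order unit easy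
  but says nothing about \<open>adj A a \<otimes> a\<close>; hence the weight of
  \<open>adj_mult_pos\<close>. Conversely, elements of \<open>pos\<close> are squares, so states are
  nonnegative on \<open>pos\<close>, which bounds them and yields compactness. Every square root
  comes with the clause that it commutes with whatever commutes with the given element; this stands
  in for a commutative functional calculus.\<close>

lemma complex_carrier: "c \<in> carrier (ring_of_type_algebra :: complex ring)"
  by (simp add: ring_of_type_algebra_def)

lemma smult_in_carrier [simp, intro]: "a \<in> carrier A \<Longrightarrow> c \<odot> a \<in> carrier A"
  using smult_closed complex_carrier by blast

lemma smult_add_left: "a \<in> carrier A \<Longrightarrow> (c + d) \<odot> a = c \<odot> a \<oplus> d \<odot> a"
  using smult_l_distr[OF complex_carrier complex_carrier, of a c d]
  by (simp add: ring_of_type_algebra_def)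

lemma smult_add_right:
  "\<lbrakk>a \<in> carrier A; b \<in> carrier A\<rbrakk> \<Longrightarrow> c \<odot> (a \<oplus> b) = c \<odot> a \<oplus> c \<odot> b"
  using smult_r_distr[OF complex_carrier, of a b c] by simp

lemma smult_smult [simp]: "a \<in> carrier A \<Longrightarrow> c \<odot> (d \<odot> a) = (c * d) \<odot> a"
  using smult_assoc1[OF complex_carrier complex_carrier, of a c d]
  by (simp add: ring_of_type_algebra_def)

lemma smult_1 [simp]: "a \<in> carrier A \<Longrightarrow> 1 \<odot> a = a"
  using smult_one[of a] by (simp add: ring_of_type_algebra_def)

lemma smult_0_left [simp]: "a \<in> carrier A \<Longrightarrow> 0 \<odot> a = \<zero>"
  using smult_l_null[of a] by (simp add: ring_of_type_algebra_def)

lemma smult_0_right [simp]: "c \<odot> \<zero> = \<zero>"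
  using smult_r_null[OF complex_carrier] .

lemma smult_minus_right: "a \<in> carrier A \<Longrightarrow> c \<odot> (\<ominus> a) = \<ominus> (c \<odot> a)"
  using smult_r_minus[OF complex_carrier] .

lemma smult_minus_left: "a \<in> carrier A \<Longrightarrow> (- c) \<odot> a = \<ominus> (c \<odot> a)"
  using smult_add_left[of a "-c" c] by (simp add: add.inv_equality)

lemma smult_diff_left: "a \<in> carrier A \<Longrightarrow> (c - d) \<odot> a = c \<odot> a \<ominus> d \<odot> a"
  using smult_add_left[of a c "-d"] by (simp add: smult_minus_left a_minus_def)

lemma smult_diff_right:
  "\<lbrakk>a \<in> carrier A; b \<in> carrier A\<rbrakk> \<Longrightarrow> c \<odot> (a \<ominus> b) = c \<odot> a \<ominus> c \<odot> b"
  by (simp add: smult_add_right smult_minus_right a_minus_def)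

lemma two_smult: "a \<in> carrier A \<Longrightarrow> 2 \<odot> a = a \<oplus> a"
  using smult_add_left[of a 1 1] by simp

declare smult_mult_left [simp] smult_mult_right [simp] adj_closed [simp, intro] adj_adj [simp]
  adj_add [simp] adj_smult [simp] adj_mult [simp]

lemma adj_zero [simp]: "adj A \<zero> = \<zero>"
  using adj_smult[of \<zero> 0] by simp

lemma adj_uminus [simp]: "a \<in> carrier A \<Longrightarrow> adj A (\<ominus> a) = \<ominus> adj A a"
  using adj_smult[of a "-1"] by (simp add: smult_minus_left)

lemma adj_diff [simp]: "\<lbrakk>a \<in> carrier A; b \<in> carrier A\<rbrakk> \<Longrightarrow> adj A (a \<ominus> b) = adj A a \<ominus> adj A b"
  by (simp add: a_minus_def)

lemma adj_one [simp]: "adj A \<one> = \<one>"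
proof -
  have "adj A \<one> = adj A (adj A \<one> \<otimes> \<one>)" by (subst adj_mult) auto
  then show ?thesis by simp
qed

lemma nrm_zero [simp]: "nrm A \<zero> = 0"
  by (simp add: nrm_eq_0)

lemma nrm_uminus [simp]: "a \<in> carrier A \<Longrightarrow> nrm A (\<ominus> a) = nrm A a"
  using nrm_smult[of a "-1"] by (simp add: smult_minus_left)

lemma nrm_nonneg [simp]: "a \<in> carrier A \<Longrightarrow> 0 \<le> nrm A a"
  using nrm_add[of a "\<ominus> a"] by (simp add: r_neg)

lemma nrm_diff: "\<lbrakk>a \<in> carrier A; b \<in> carrier A\<rbrakk> \<Longrightarrow> nrm A (a \<ominus> b) \<le> nrm A a + nrm A b"
  using nrm_add[of a "\<ominus> b"] by (simp add: a_minus_def)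

lemma nrm_minus_commute: "\<lbrakk>a \<in> carrier A; b \<in> carrier A\<rbrakk> \<Longrightarrow> nrm A (a \<ominus> b) = nrm A (b \<ominus> a)"
  using nrm_uminus[of "a \<ominus> b"] by (simp add: a_minus_def minus_add a_comm)

lemma nrm_triangle:
  assumes "a \<in> carrier A" "b \<in> carrier A" "c \<in> carrier A"
  shows "nrm A (a \<ominus> c) \<le> nrm A (a \<ominus> b) + nrm A (b \<ominus> c)"
proof -
  have "a \<ominus> c = (a \<ominus> b) \<oplus> (b \<ominus> c)" using assms by algebra
  then show ?thesis using nrm_add[of "a \<ominus> b" "b \<ominus> c"] assms by simp
qed

lemma diff_eq_0: "\<lbrakk>a \<in> carrier A; b \<in> carrier A\<rbrakk> \<Longrightarrow> a \<ominus> b = \<zero> \<longleftrightarrow> a = b"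
  by (simp add: right_minus_eq)

lemma nrm_one [simp]: "nrm A \<one> = 1"
proof -
  have "nrm A \<one> = (nrm A \<one>)\<^sup>2" using nrm_cstar[of \<one>] by simp
  moreover have "nrm A \<one> \<noteq> 0" using nrm_eq_0 one_neq_zero by simp
  ultimately show ?thesis by (simp add: power2_eq_square)
qed

lemma nrm_adj [simp]:
  assumes a: "a \<in> carrier A" shows "nrm A (adj A a) = nrm A a"
proof -
  have le: "nrm A b \<le> nrm A (adj A b)" if b: "b \<in> carrier A" for b
  proof (cases "nrm A b = 0")
    case False
    have "nrm A b * nrm A b \<le> nrm A (adj A b) * nrm A b"
      using nrm_cstar[OF b] nrm_mult[of "adj A b" b] b by (simp add: power2_eq_square)
    then show ?thesis using False nrm_nonneg[OF b] by (simp add: mult_le_cancel_right)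
  qed (use b in simp)
  show ?thesis using le[OF a] le[of "adj A a"] a by simp
qed

lemma sa_iff: "a \<in> sa A \<longleftrightarrow> a \<in> carrier A \<and> adj A a = a"
  by (simp add: sa_def)

lemma sa_carrier: "a \<in> sa A \<Longrightarrow> a \<in> carrier A"
  by (simp add: sa_iff)

lemma nrm_sa_square: "a \<in> sa A \<Longrightarrow> nrm A (a \<otimes> a) = (nrm A a)\<^sup>2"
  using nrm_cstar[of a] by (simp add: sa_iff)

lemma sa_zero [simp]: "\<zero> \<in> sa A" and sa_one [simp]: "\<one> \<in> sa A"
  by (simp_all add: sa_iff)

lemma sa_add [simp]: "\<lbrakk>a \<in> sa A; b \<in> sa A\<rbrakk> \<Longrightarrow> a \<oplus> b \<in> sa A"
  and sa_diff [simp]: "\<lbrakk>a \<in> sa A; b \<in> sa A\<rbrakk> \<Longrightarrow> a \<ominus> b \<in> sa A"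
  and sa_uminus [simp]: "a \<in> sa A \<Longrightarrow> \<ominus> a \<in> sa A"
  and sa_smult [simp]: "a \<in> sa A \<Longrightarrow> complex_of_real r \<odot> a \<in> sa A"
  and sa_mult: "\<lbrakk>a \<in> sa A; b \<in> sa A; a \<otimes> b = b \<otimes> a\<rbrakk> \<Longrightarrow> a \<otimes> b \<in> sa A"
  and sa_adj_mult: "c \<in> carrier A \<Longrightarrow> adj A c \<otimes> c \<in> sa A"
  by (simp_all add: sa_iff)

section \<open>The norm metric and limits of sequences\<close>

lemma Metric_space_cstar_dist: "Metric_space (carrier A) (cstar_dist A)"
proof
  fix x y z
  show "0 \<le> cstar_dist A x y" by (simp add: cstar_dist_def)
  show "cstar_dist A x y = cstar_dist A y x" by (simp add: cstar_dist_def nrm_minus_commute)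
  show "\<lbrakk>x \<in> carrier A; y \<in> carrier A\<rbrakk> \<Longrightarrow> cstar_dist A x y = 0 \<longleftrightarrow> x = y"
    by (simp add: cstar_dist_def nrm_eq_0 diff_eq_0)
  show "\<lbrakk>x \<in> carrier A; y \<in> carrier A; z \<in> carrier A\<rbrakk>
    \<Longrightarrow> cstar_dist A x z \<le> cstar_dist A x y + cstar_dist A y z"
    by (simp add: cstar_dist_def nrm_triangle)
qed

text \<open>Convergence is reduced to a real null sequence, so that limit laws become norm estimates
  fed to \<open>convI\<close>; completeness of the metric is translated into this form in
  \<open>conv_of_dominated\<close>.\<close>

definition conv :: "(nat \<Rightarrow> 'a) \<Rightarrow> 'a \<Rightarrow> bool" where
  "conv f a \<longleftrightarrow> range f \<subseteq> carrier A \<and> a \<in> carrier A \<and> (\<lambda>n. nrm A (f n \<ominus> a)) \<longlonglongrightarrow> 0"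

lemma convI:
  assumes "\<And>n. f n \<in> carrier A" "a \<in> carrier A" "\<And>n. nrm A (f n \<ominus> a) \<le> g n" "g \<longlonglongrightarrow> 0"
  shows "conv f a"
proof -
  have "(\<lambda>n. nrm A (f n \<ominus> a)) \<longlonglongrightarrow> 0"
    by (rule tendsto_sandwich[OF _ _ tendsto_const assms(4)]) (use assms in auto)
  then show ?thesis using assms by (auto simp: conv_def)
qed

lemma convD:
  assumes "conv f a"
  shows "f n \<in> carrier A" "a \<in> carrier A" "(\<lambda>n. nrm A (f n \<ominus> a)) \<longlonglongrightarrow> 0"
  using assms by (auto simp: conv_def)

lemma conv_unique:
  assumes "conv f a" "conv f b" shows "a = b"
proof -
  note fa = convD[OF assms(1)] and fb = convD[OF assms(2)]
  have "(\<lambda>n. nrm A (f n \<ominus> a) + nrm A (f n \<ominus> b)) \<longlonglongrightarrow> 0"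
    using tendsto_add[OF fa(3) fb(3)] by simp
  moreover have "nrm A (a \<ominus> b) \<le> nrm A (f n \<ominus> a) + nrm A (f n \<ominus> b)" for n
    using nrm_triangle[of a "f n" b] fa(1,2) fb(1,2) by (simp add: nrm_minus_commute)
  ultimately have "nrm A (a \<ominus> b) \<le> 0"
    by (meson LIMSEQ_le_const)
  then have "nrm A (a \<ominus> b) = 0" using fa(2) fb(2) by (intro order.antisym) auto
  then show ?thesis using fa(2) fb(2) by (simp add: nrm_eq_0 diff_eq_0)
qed

lemma conv_const: "a \<in> carrier A \<Longrightarrow> conv (\<lambda>_. a) a"
  by (auto simp: conv_def diff_eq_0[THEN iffD2])

lemma conv_Suc: "conv f a \<Longrightarrow> conv (\<lambda>n. f (Suc n)) a"
  by (auto simp: conv_def intro: LIMSEQ_Suc[of "\<lambda>n. nrm A (f n \<ominus> a)"])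

lemma conv_add:
  assumes "conv f a" "conv g b" shows "conv (\<lambda>n. f n \<oplus> g n) (a \<oplus> b)"
proof (rule convI)
  note fa = convD[OF assms(1)] and gb = convD[OF assms(2)]
  show "f n \<oplus> g n \<in> carrier A" "a \<oplus> b \<in> carrier A" for n using fa gb by auto
  show "(\<lambda>n. nrm A (f n \<ominus> a) + nrm A (g n \<ominus> b)) \<longlonglongrightarrow> 0"
    using tendsto_add[OF fa(3) gb(3)] by simp
  fix n
  have "(f n \<oplus> g n) \<ominus> (a \<oplus> b) = (f n \<ominus> a) \<oplus> (g n \<ominus> b)"
    using fa(1)[of n] fa(2) gb(1)[of n] gb(2) by algebra
  then show "nrm A ((f n \<oplus> g n) \<ominus> (a \<oplus> b)) \<le> nrm A (f n \<ominus> a) + nrm A (g n \<ominus> b)"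
    using nrm_add[of "f n \<ominus> a" "g n \<ominus> b"] fa gb by simp
qed

lemma conv_smult:
  assumes "conv f a" shows "conv (\<lambda>n. c \<odot> f n) (c \<odot> a)"
proof (rule convI)
  note fa = convD[OF assms(1)]
  show "c \<odot> f n \<in> carrier A" "c \<odot> a \<in> carrier A" for n using fa by auto
  show "(\<lambda>n. cmod c * nrm A (f n \<ominus> a)) \<longlonglongrightarrow> 0"
    using tendsto_mult_left[OF fa(3), of "cmod c"] by simp
  show "nrm A (c \<odot> f n \<ominus> c \<odot> a) \<le> cmod c * nrm A (f n \<ominus> a)" for n
    using nrm_smult[of "f n \<ominus> a" c] fa by (simp add: smult_diff_right)
qed

lemma conv_adj:
  assumes "conv f a" shows "conv (\<lambda>n. adj A (f n)) (adj A a)"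
proof (rule convI)
  note fa = convD[OF assms(1)]
  show "adj A (f n) \<in> carrier A" "adj A a \<in> carrier A" for n using fa by auto
  show "nrm A (adj A (f n) \<ominus> adj A a) \<le> nrm A (f n \<ominus> a)" for n
    using nrm_adj[of "f n \<ominus> a"] fa by simp
qed (use convD[OF assms] in blast)

lemma nrm_le_of_conv:
  assumes "conv f a" "\<And>n. nrm A (f n) \<le> B" shows "nrm A a \<le> B"
proof -
  note fa = convD[OF assms(1)]
  have "nrm A a \<le> B + nrm A (f n \<ominus> a)" for n
  proof -
    have "a = f n \<ominus> (f n \<ominus> a)" using fa(1)[of n] fa(2) by algebra
    then have "nrm A a \<le> nrm A (f n) + nrm A (f n \<ominus> a)"
      using nrm_diff[of "f n" "f n \<ominus> a"] fa by simp
    then show ?thesis using assms(2)[of n] by simp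
  qed
  moreover have "(\<lambda>n. B + nrm A (f n \<ominus> a)) \<longlonglongrightarrow> B" using tendsto_add[OF tendsto_const fa(3)] by simp
  ultimately show ?thesis by (meson LIMSEQ_le_const)
qed

text \<open>Rests on \<open>f g - a b = (f - a) g + a (g - b)\<close>. The bound \<open>B\<close>
  controls the factor \<open>g\<close> in the first term; it is explicit in every
  application.\<close>

lemma conv_mult:
  assumes "conv f a" "conv g b" "\<And>n. nrm A (g n) \<le> B"
  shows "conv (\<lambda>n. f n \<otimes> g n) (a \<otimes> b)"
proof (rule convI)
  note fa = convD[OF assms(1)] and gb = convD[OF assms(2)]
  show "f n \<otimes> g n \<in> carrier A" "a \<otimes> b \<in> carrier A" for n using fa gb by auto
  show "(\<lambda>n. nrm A (f n \<ominus> a) * B + nrm A a * nrm A (g n \<ominus> b)) \<longlonglongrightarrow> 0"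
    using tendsto_add[OF tendsto_mult_right[OF fa(3), of B] tendsto_mult_left[OF gb(3), of "nrm A a"]]
    by simp
  fix n
  have *: "(f n \<otimes> g n) \<ominus> (a \<otimes> b) = (f n \<ominus> a) \<otimes> g n \<oplus> a \<otimes> (g n \<ominus> b)"
    using fa(1)[of n] fa(2) gb(1)[of n] gb(2) by algebra
  have "nrm A ((f n \<otimes> g n) \<ominus> (a \<otimes> b)) \<le> nrm A ((f n \<ominus> a) \<otimes> g n) + nrm A (a \<otimes> (g n \<ominus> b))"
    unfolding * using fa gb by (intro nrm_add) auto
  also have "\<dots> \<le> nrm A (f n \<ominus> a) * nrm A (g n) + nrm A a * nrm A (g n \<ominus> b)"
    using fa gb by (intro add_mono nrm_mult) auto
  also have "\<dots> \<le> nrm A (f n \<ominus> a) * B + nrm A a * nrm A (g n \<ominus> b)"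
    using fa gb assms(3)[of n] by (intro add_mono mult_left_mono) auto
  finally show "nrm A ((f n \<otimes> g n) \<ominus> (a \<otimes> b)) \<le> nrm A (f n \<ominus> a) * B + nrm A a * nrm A (g n \<ominus> b)" .
qed

text \<open>Majorant method: the increments of \<open>f\<close> telescope against those of
  \<open>u\<close>, so \<open>f\<close> inherits the Cauchy property without any contraction
  factor.\<close>

lemma conv_of_dominated:
  assumes f: "\<And>n. f n \<in> carrier A" and u: "convergent u"
    and step: "\<And>n. nrm A (f (Suc n) \<ominus> f n) \<le> u (Suc n) - u n"
  shows "\<exists>a. conv f a"
proof -
  interpret Metric_space "carrier A" "cstar_dist A" by (rule Metric_space_cstar_dist)
  have diff: "nrm A (f (n + k) \<ominus> f n) \<le> u (n + k) - u n" for n k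
  proof (induction k)
    case 0
    then show ?case using f by (simp add: diff_eq_0[THEN iffD2])
  next
    case (Suc k)
    then show ?case
      using step[of "n + k"] nrm_triangle[of "f (Suc (n + k))" "f (n + k)" "f n"] f by simp
  qed
  have "MCauchy f"
    unfolding MCauchy_def
  proof (intro conjI allI impI)
    show "range f \<subseteq> carrier A" using f by blast
    fix e :: real assume "e > 0"
    then obtain N where N: "\<And>m n. m \<ge> N \<Longrightarrow> n \<ge> N \<Longrightarrow> dist (u m) (u n) < e"
      using convergent_Cauchy[OF u] unfolding Cauchy_def by blast
    have *: "nrm A (f m \<ominus> f n) < e" if "N \<le> n" "n \<le> m" for m n
      using diff[of n "m - n"] N[of m n] that by (simp add: dist_real_def)
    have "cstar_dist A (f n) (f n') < e" if "N \<le> n" "N \<le> n'" for n n'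
      using *[of n n'] *[of n' n] that f by (cases "n \<le> n'") (auto simp: cstar_dist_def nrm_minus_commute)
    then show "\<exists>N. \<forall>n n'. N \<le> n \<longrightarrow> N \<le> n' \<longrightarrow> cstar_dist A (f n) (f n') < e" by blast
  qed
  then obtain a where a: "limitin mtopology f a sequentially"
    using complete unfolding mcomplete_def by blast
  then have "a \<in> carrier A" "(\<lambda>n. cstar_dist A (f n) a) \<longlonglongrightarrow> 0"
    by (auto simp: limitin_metric_dist_null)
  then have "conv f a" using f by (auto simp: conv_def cstar_dist_def)
  then show ?thesis ..
qed

end


section \<open>The positive cone\<close>

context unital_cstar_algebra
begin

text \<open>The equation \<open>y = (h + y y) / 2\<close> is \<open>(1 - y) (1 - y) = 1 - h\<close>
  rewritten as a fixed point problem. On the unit ball the map need not be a strict contraction, so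
  convergence comes from a scalar majorant.\<close>

lemma ex_sqrt_one_minus:
  assumes h: "h \<in> sa A" and h1: "nrm A h \<le> 1"
  shows "\<exists>y\<in>sa A. nrm A y \<le> 1 \<and> (\<one> \<ominus> y) \<otimes> (\<one> \<ominus> y) = \<one> \<ominus> h \<and>
    (\<forall>x\<in>carrier A. x \<otimes> h = h \<otimes> x \<longrightarrow> x \<otimes> y = y \<otimes> x)"
proof -
  have hc [simp]: "h \<in> carrier A" and ha [simp]: "adj A h = h" using h by (auto simp: sa_iff)
  define Y where "Y = rec_nat \<zero> (\<lambda>_ y. (1/2) \<odot> (h \<oplus> y \<otimes> y))"
  \<comment> \<open>\<open>u\<close> is the same iteration with the scalar 1 in place of
    \<open>h\<close>, the extreme case; it increases and stays below 1.\<close>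
  define u :: "nat \<Rightarrow> real" where "u = rec_nat 0 (\<lambda>_ v. (1 + v\<^sup>2) / 2)"
  have Y0: "Y 0 = \<zero>" and YS: "Y (Suc n) = (1/2) \<odot> (h \<oplus> Y n \<otimes> Y n)" for n
    by (simp_all add: Y_def)
  have u0: "u 0 = 0" and uS: "u (Suc n) = (1 + (u n)\<^sup>2) / 2" for n
    by (simp_all add: u_def)
  have Yc [simp]: "Y n \<in> carrier A" for n by (induction n) (simp_all add: Y0 YS)
  have Ya: "adj A (Y n) = Y n" for n by (induction n) (simp_all add: Y0 YS)
  have u01: "0 \<le> u n \<and> u n \<le> 1" for n
  proof (induction n)
    case (Suc n)
    then have "(u n)\<^sup>2 \<le> 1" by (simp add: power_le_one)
    then show ?case by (simp add: uS)
  qed (simp add: u0)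
  have "u n \<le> u (Suc n)" for n
    using zero_le_power2[of "1 - u n"] by (simp add: uS power2_eq_square algebra_simps)
  then have u_conv: "convergent u"
    using u01 by (intro Bseq_mono_convergent) (auto simp: Bseq_def incseq_SucI intro!: exI[of _ 1] incseqD)
  have Yu: "nrm A (Y n) \<le> u n" for n
  proof (induction n)
    case (Suc n)
    have "nrm A (h \<oplus> Y n \<otimes> Y n) \<le> nrm A h + nrm A (Y n) * nrm A (Y n)"
      using nrm_add[of h "Y n \<otimes> Y n"] nrm_mult[of "Y n" "Y n"] by simp
    also have "\<dots> \<le> 1 + u n * u n"
      using Suc h1 u01[of n] by (intro add_mono mult_mono) auto
    finally show ?case by (simp add: YS uS nrm_smult power2_eq_square norm_divide)
  qed (simp add: Y0 u0)
  have step: "nrm A (Y (Suc n) \<ominus> Y n) \<le> u (Suc n) - u n" for n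
  proof (induction n)
    case 0
    then show ?case using h1 by (simp add: YS Y0 uS u0 nrm_smult a_minus_def norm_divide)
  next
    case (Suc n)
    let ?y = "Y n" and ?z = "Y (Suc n)"
    \<comment> \<open>Difference of squares without commutativity:
      \<open>z z - y y = z (z - y) + (z - y) y\<close>. The same identity for \<open>u\<close>
      closes the induction.\<close>
    have "(h \<oplus> ?z \<otimes> ?z) \<ominus> (h \<oplus> ?y \<otimes> ?y) = ?z \<otimes> (?z \<ominus> ?y) \<oplus> (?z \<ominus> ?y) \<otimes> ?y"
      using hc Yc[of n] Yc[of "Suc n"] by algebra
    then have "Y (Suc (Suc n)) \<ominus> ?z = (1/2) \<odot> (?z \<otimes> (?z \<ominus> ?y) \<oplus> (?z \<ominus> ?y) \<otimes> ?y)"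
      unfolding YS[of "Suc n"] by (subst YS[of n]) (simp flip: smult_diff_right)
    then have "nrm A (Y (Suc (Suc n)) \<ominus> ?z)
        = (1/2) * nrm A (?z \<otimes> (?z \<ominus> ?y) \<oplus> (?z \<ominus> ?y) \<otimes> ?y)"
      by (simp add: nrm_smult norm_divide)
    also have "\<dots> \<le> (1/2) * (nrm A ?z * nrm A (?z \<ominus> ?y) + nrm A (?z \<ominus> ?y) * nrm A ?y)"
      by (intro mult_left_mono order.trans[OF nrm_add] add_mono nrm_mult) auto
    also have "\<dots> \<le> (1/2) * (u (Suc n) * (u (Suc n) - u n) + (u (Suc n) - u n) * u n)"
      using Suc Yu[of n] Yu[of "Suc n"] u01 order.trans[OF nrm_nonneg Suc]
      by (intro mult_left_mono add_mono mult_mono) auto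
    also have "\<dots> = u (Suc (Suc n)) - u (Suc n)"
      by (simp add: uS[of "Suc n"] uS[of n] power2_eq_square field_simps)
    finally show ?case .
  qed
  obtain y where y: "conv Y y" using conv_of_dominated[OF Yc u_conv step] by blast
  have yc [simp]: "y \<in> carrier A" using convD(2)[OF y] .
  have Y1: "nrm A (Y n) \<le> 1" for n using Yu u01 order.trans by blast
  have "y \<in> sa A"
    using conv_unique[OF conv_adj[OF y, unfolded Ya] y] by (simp add: sa_iff)
  moreover have "nrm A y \<le> 1" using nrm_le_of_conv[OF y Y1] .
  moreover have "(\<one> \<ominus> y) \<otimes> (\<one> \<ominus> y) = \<one> \<ominus> h"
  proof -
    have "conv (\<lambda>n. Y (Suc n)) ((1/2) \<odot> (h \<oplus> y \<otimes> y))"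
      unfolding YS by (intro conv_smult conv_add conv_const conv_mult[OF y y Y1]) simp
    then have "y = (1/2) \<odot> (h \<oplus> y \<otimes> y)" using conv_unique[OF conv_Suc[OF y]] by blast
    then have "2 \<odot> y = 2 \<odot> ((1/2) \<odot> (h \<oplus> y \<otimes> y))" by (rule arg_cong)
    then have 2: "y \<oplus> y = h \<oplus> y \<otimes> y" by (simp add: two_smult)
    have "(\<one> \<ominus> y) \<otimes> (\<one> \<ominus> y) = \<one> \<ominus> (y \<oplus> y) \<oplus> y \<otimes> y"
      by (simp add: a_minus_def l_distr r_distr l_minus r_minus minus_add a_ac)
    also have "\<dots> = \<one> \<ominus> h"
      unfolding 2 using one_closed yc hc by algebra
    finally show ?thesis .
  qed
  moreover have "x \<otimes> y = y \<otimes> x" if x: "x \<in> carrier A" "x \<otimes> h = h \<otimes> x" for x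
  proof -
    have comm: "x \<otimes> Y n = Y n \<otimes> x" for n
    proof (induction n)
      case (Suc n)
      have "x \<otimes> (Y n \<otimes> Y n) = Y n \<otimes> Y n \<otimes> x"
        using Suc x(1) by (metis m_assoc Yc)
      then show ?case using x by (simp add: YS r_distr l_distr)
    qed (use x in \<open>simp add: Y0\<close>)
    have "conv (\<lambda>n. x \<otimes> Y n) (x \<otimes> y)" using conv_mult[OF conv_const[OF x(1)] y Y1] .
    moreover have "conv (\<lambda>n. Y n \<otimes> x) (y \<otimes> x)"
      using conv_mult[OF y conv_const[OF x(1)] order.refl] .
    ultimately show ?thesis unfolding comm by (rule conv_unique)
  qed
  ultimately show ?thesis by blast
qed

text \<open>In spectral terms these are the self-adjoint elements with nonnegative spectrum: the
  ball of radius \<open>s\<close> about \<open>s\<close> meets the real line in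
  \<open>[0, 2 s]\<close>. Leaving \<open>s\<close> existential lets the radii simply add up for
  sums.\<close>

definition pos :: "'a set" where
  "pos = {h \<in> sa A. \<exists>s\<ge>0. nrm A (complex_of_real s \<odot> \<one> \<ominus> h) \<le> s}"

lemma pos_sa: "h \<in> pos \<Longrightarrow> h \<in> sa A"
  by (simp add: pos_def)

lemma pos_carrier: "h \<in> pos \<Longrightarrow> h \<in> carrier A"
  by (simp add: pos_sa sa_carrier)

lemma pos_add: "\<lbrakk>g \<in> pos; h \<in> pos\<rbrakk> \<Longrightarrow> g \<oplus> h \<in> pos"
proof -
  assume g: "g \<in> pos" and h: "h \<in> pos"
  then have gh: "g \<in> carrier A" "h \<in> carrier A" by (auto simp: pos_carrier)
  obtain s t where s: "s \<ge> 0" "nrm A (complex_of_real s \<odot> \<one> \<ominus> g) \<le> s"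
    and t: "t \<ge> 0" "nrm A (complex_of_real t \<odot> \<one> \<ominus> h) \<le> t"
    using g h by (auto simp: pos_def)
  have "complex_of_real (s + t) \<odot> \<one> \<ominus> (g \<oplus> h)
      = (complex_of_real s \<odot> \<one> \<oplus> complex_of_real t \<odot> \<one>) \<ominus> (g \<oplus> h)"
    by (simp add: smult_add_left)
  also have "\<dots> = (complex_of_real s \<odot> \<one> \<ominus> g) \<oplus> (complex_of_real t \<odot> \<one> \<ominus> h)"
    using gh smult_in_carrier[OF one_closed, of "complex_of_real s"]
      smult_in_carrier[OF one_closed, of "complex_of_real t"] by algebra
  finally have "nrm A (complex_of_real (s + t) \<odot> \<one> \<ominus> (g \<oplus> h))
      \<le> nrm A (complex_of_real s \<odot> \<one> \<ominus> g) + nrm A (complex_of_real t \<odot> \<one> \<ominus> h)"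
    using nrm_add gh by simp
  then have "nrm A (complex_of_real (s + t) \<odot> \<one> \<ominus> (g \<oplus> h)) \<le> s + t" using s t by simp
  then show ?thesis using s(1) t(1) pos_sa[OF g] pos_sa[OF h]
    by (auto simp: pos_def simp del: of_real_add intro!: exI[of _ "s + t"])
qed

lemma pos_smult:
  assumes h: "h \<in> pos" and t: "t \<ge> 0" shows "complex_of_real t \<odot> h \<in> pos"
proof -
  have hc: "h \<in> carrier A" using h by (rule pos_carrier)
  obtain s where s: "s \<ge> 0" "nrm A (complex_of_real s \<odot> \<one> \<ominus> h) \<le> s"
    using h by (auto simp: pos_def)
  have "complex_of_real (t * s) \<odot> \<one> \<ominus> complex_of_real t \<odot> h
      = complex_of_real t \<odot> (complex_of_real s \<odot> \<one> \<ominus> h)"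
    using hc by (simp add: smult_diff_right)
  then have "nrm A (complex_of_real (t * s) \<odot> \<one> \<ominus> complex_of_real t \<odot> h) \<le> t * s"
    using s t hc by (simp add: nrm_smult mult_left_mono)
  then show ?thesis using s t h unfolding pos_def by (auto intro!: exI[of _ "t * s"])
qed

text \<open>The witness is \<open>s\<close> itself, since \<open>s - (s - h) = h\<close>. This makes
  \<open>\<one>\<close> an order unit; \<open>nrm_le_of_pos\<close> is a partial converse.\<close>

lemma pos_nrm_diff:
  assumes "h \<in> sa A" "nrm A h \<le> s" shows "complex_of_real s \<odot> \<one> \<ominus> h \<in> pos"
proof -
  have hc: "h \<in> carrier A" using assms(1) by (rule sa_carrier)
  have "complex_of_real s \<odot> \<one> \<ominus> (complex_of_real s \<odot> \<one> \<ominus> h) = h"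
    using hc smult_in_carrier[OF one_closed, of "complex_of_real s"] by algebra
  then show ?thesis
    using assms nrm_nonneg[OF hc] unfolding pos_def by (auto intro!: exI[of _ s])
qed

text \<open>The ball condition reads \<open>|s - r| \<le> s\<close>. The case \<open>r = -1\<close>
  makes \<open>pos\<close> a proper cone.\<close>

lemma scalar_pos_iff: "complex_of_real r \<odot> \<one> \<in> pos \<longleftrightarrow> 0 \<le> r"
proof
  assume "complex_of_real r \<odot> \<one> \<in> pos"
  then obtain s where "nrm A (complex_of_real s \<odot> \<one> \<ominus> complex_of_real r \<odot> \<one>) \<le> s"
    by (auto simp: pos_def)
  then have "cmod (complex_of_real (s - r)) \<le> s"
    by (simp add: nrm_smult flip: smult_diff_left)
  then show "0 \<le> r" unfolding norm_of_real by simp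
next
  assume "0 \<le> r"
  then show "complex_of_real r \<odot> \<one> \<in> pos"
    by (auto simp: pos_def diff_eq_0[THEN iffD2] intro!: exI[of _ r])
qed

lemma pos_zero: "\<zero> \<in> pos" and pos_one: "\<one> \<in> pos"
  using scalar_pos_iff[of 0] scalar_pos_iff[of 1] by simp_all

lemma pos_sqrt:
  assumes h: "h \<in> pos"
  obtains r where "r \<in> pos" "r \<otimes> r = h"
    "\<And>x. \<lbrakk>x \<in> carrier A; x \<otimes> h = h \<otimes> x\<rbrakk> \<Longrightarrow> x \<otimes> r = r \<otimes> x"
proof -
  have hc [simp]: "h \<in> carrier A" and hs: "h \<in> sa A" using h by (auto simp: pos_carrier pos_sa)
  obtain s where s: "s \<ge> 0" "nrm A (complex_of_real s \<odot> \<one> \<ominus> h) \<le> s"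
    using h by (auto simp: pos_def)
  show ?thesis
  proof (cases "s = 0")
    case True
    then have "nrm A h \<le> 0" using s(2) by (simp add: a_minus_def)
    then have "h = \<zero>" using nrm_eq_0[OF hc] nrm_nonneg[OF hc] by linarith
    then show ?thesis using that[of \<zero>] by (simp add: pos_zero)
  next
    case False
    with s have s0: "s > 0" by simp
    \<comment> \<open>By the choice of \<open>s\<close>, \<open>g\<close> has norm at most 1, so a
      root \<open>1 - y\<close> of \<open>1 - g\<close>, which is \<open>h / s\<close>, exists;
      rescaling by \<open>sqrt s\<close> gives \<open>r\<close>. The case \<open>s = 0\<close> was
      split off to allow this division.\<close>
    define g where "g = \<one> \<ominus> complex_of_real (1/s) \<odot> h"
    have gs: "g \<in> sa A" unfolding g_def by (intro sa_diff sa_smult sa_one hs)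
    have gc: "g \<in> carrier A" using gs by (rule sa_carrier)
    have "g = complex_of_real (1/s) \<odot> (complex_of_real s \<odot> \<one> \<ominus> h)"
      using s0 by (simp add: g_def smult_diff_right)
    then have "nrm A g = 1/s * nrm A (complex_of_real s \<odot> \<one> \<ominus> h)"
      using s0 by (simp add: nrm_smult norm_divide)
    also have "\<dots> \<le> 1" using s s0 by simp
    finally obtain y where y: "y \<in> sa A" "nrm A y \<le> 1" "(\<one> \<ominus> y) \<otimes> (\<one> \<ominus> y) = \<one> \<ominus> g"
      "\<And>x. \<lbrakk>x \<in> carrier A; x \<otimes> g = g \<otimes> x\<rbrakk> \<Longrightarrow> x \<otimes> y = y \<otimes> x"
      using ex_sqrt_one_minus[OF gs] by blast
    have yc [simp]: "y \<in> carrier A" using y(1) by (rule sa_carrier)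
    define r where "r = complex_of_real (sqrt s) \<odot> (\<one> \<ominus> y)"
    have "\<one> \<ominus> g = complex_of_real (1/s) \<odot> h"
      unfolding g_def using hc smult_in_carrier[OF hc, of "complex_of_real (1/s)"] one_closed by algebra
    moreover have "complex_of_real (sqrt s) * complex_of_real (sqrt s) = complex_of_real s"
      using s0 by (simp flip: of_real_mult)
    ultimately have "r \<otimes> r = h" using s0 by (simp add: r_def y(3))
    moreover have "r \<in> pos"
      unfolding r_def using pos_smult[OF pos_nrm_diff[OF y(1,2)], of "sqrt s"] s by simp
    moreover have "x \<otimes> r = r \<otimes> x" if x: "x \<in> carrier A" "x \<otimes> h = h \<otimes> x" for x
    proof -
      have "x \<otimes> g = g \<otimes> x"
        using x by (simp add: g_def a_minus_def r_distr l_distr r_minus l_minus)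
      then have "x \<otimes> y = y \<otimes> x" using y(4) x by blast
      then show ?thesis using x by (simp add: r_def a_minus_def r_distr l_distr r_minus l_minus)
    qed
    ultimately show ?thesis using that by blast
  qed
qed

text \<open>The element \<open>k + \<i> l\<close> is a multiple of a unitary.\<close>

lemma nrm_sq_le_of_square_sum:
  assumes k: "k \<in> sa A" and l: "l \<in> sa A" and kl: "k \<otimes> l = l \<otimes> k"
    and sum: "k \<otimes> k \<oplus> l \<otimes> l = complex_of_real t \<odot> \<one>" and t: "0 \<le> t"
  shows "(nrm A k)\<^sup>2 \<le> t"
proof -
  have kc [simp]: "k \<in> carrier A" "adj A k = k" and lc [simp]: "l \<in> carrier A" "adj A l = l"
    using k l by (auto simp: sa_iff)
  \<comment> \<open>Hiding the scalar \<open>\<i>\<close> inside \<open>v\<close> leaves pure ring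
    identities, which \<open>algebra\<close> can decide.\<close>
  define v where "v = \<i> \<odot> l"
  have vc [simp]: "v \<in> carrier A" by (simp add: v_def)
  have kv: "k \<otimes> v = v \<otimes> k" by (simp add: v_def kl)
  have vv: "v \<otimes> v = \<ominus> (l \<otimes> l)" by (simp add: v_def smult_minus_left)
  have adj: "adj A (k \<oplus> v) = k \<ominus> v" by (simp add: v_def a_minus_def smult_minus_left)
  have "adj A (k \<oplus> v) \<otimes> (k \<oplus> v) = k \<otimes> k \<oplus> (k \<otimes> v \<ominus> v \<otimes> k) \<ominus> v \<otimes> v"
    unfolding adj using kc(1) vc by algebra
  also have "\<dots> = complex_of_real t \<odot> \<one>"
    by (simp add: kv vv diff_eq_0[THEN iffD2] a_minus_def r_neg flip: sum)
  finally have "(nrm A (k \<oplus> v))\<^sup>2 = t"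
    using nrm_cstar[of "k \<oplus> v"] t by (simp add: nrm_smult)
  moreover have "nrm A k \<le> nrm A (k \<oplus> v)"
  proof -
    \<comment> \<open>\<open>k\<close> is the real part of \<open>k \<oplus> v\<close>, and the
      adjoint is isometric.\<close>
    have "2 \<odot> k = (k \<oplus> v) \<oplus> adj A (k \<oplus> v)"
      unfolding adj two_smult[OF kc(1)] using kc(1) vc by algebra
    then have "2 * nrm A k \<le> 2 * nrm A (k \<oplus> v)"
      using nrm_add[of "k \<oplus> v" "adj A (k \<oplus> v)"] nrm_adj[of "k \<oplus> v"] nrm_smult[of k 2]
      by (simp del: adj_add)
    then show ?thesis by simp
  qed
  ultimately show ?thesis using power_mono[of "nrm A k" "nrm A (k \<oplus> v)" 2] by simp
qed

text \<open>For \<open>g\<close> of norm at most 1, let \<open>w\<close> be the root of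
  \<open>1 - g g\<close>. It commutes with \<open>g\<close> and \<open>w w + g g = 1\<close>, so the
  norm of \<open>1 - g g\<close> is the squared norm of \<open>w\<close>, hence at most 1, and
  \<open>s = 1\<close> is a witness. The rest is scaling.\<close>

lemma square_pos:
  assumes h: "h \<in> sa A" shows "h \<otimes> h \<in> pos"
proof -
  have *: "g \<otimes> g \<in> pos" if g: "g \<in> sa A" "nrm A g \<le> 1" for g
  proof -
    have gc [simp]: "g \<in> carrier A" using g by (simp add: sa_iff)
    have ggs: "g \<otimes> g \<in> sa A" using g by (intro sa_mult) auto
    have "nrm A (g \<otimes> g) \<le> 1" using g by (simp add: nrm_sa_square power_le_one)
    then obtain y where y: "y \<in> sa A" "(\<one> \<ominus> y) \<otimes> (\<one> \<ominus> y) = \<one> \<ominus> g \<otimes> g"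
      "\<And>x. \<lbrakk>x \<in> carrier A; x \<otimes> (g \<otimes> g) = g \<otimes> g \<otimes> x\<rbrakk> \<Longrightarrow> x \<otimes> y = y \<otimes> x"
      using ex_sqrt_one_minus[OF ggs] by blast
    have yc [simp]: "y \<in> carrier A" using y(1) by (rule sa_carrier)
    have ws: "\<one> \<ominus> y \<in> sa A" using y(1) by simp
    have "g \<otimes> y = y \<otimes> g" by (rule y(3)) (simp_all add: m_assoc)
    then have comm: "(\<one> \<ominus> y) \<otimes> g = g \<otimes> (\<one> \<ominus> y)"
      by (simp add: a_minus_def r_distr l_distr r_minus l_minus)
    have "(\<one> \<ominus> y) \<otimes> (\<one> \<ominus> y) \<oplus> g \<otimes> g = complex_of_real 1 \<odot> \<one>"
      unfolding y(2) using one_closed gc by (simp, algebra)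
    from nrm_sq_le_of_square_sum[OF ws g(1) comm this]
    have "nrm A (\<one> \<ominus> g \<otimes> g) \<le> 1" using nrm_sa_square[OF ws] y(2) by simp
    then show ?thesis using ggs unfolding pos_def by (auto intro!: exI[of _ 1])
  qed
  have hc [simp]: "h \<in> carrier A" using h by (simp add: sa_iff)
  show ?thesis
  proof (cases "nrm A h = 0")
    case True
    then show ?thesis using pos_zero by (simp add: nrm_eq_0)
  next
    case False
    define n where "n = nrm A h"
    have n: "n > 0" using False nrm_nonneg[OF hc] unfolding n_def by linarith
    have "nrm A (complex_of_real (1/n) \<odot> h) \<le> 1"
      using n by (simp add: nrm_smult norm_divide n_def)
    then have "complex_of_real (n * n) \<odot> ((complex_of_real (1/n) \<odot> h) \<otimes> (complex_of_real (1/n) \<odot> h)) \<in> pos"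
      by (intro pos_smult * sa_smult h) simp_all
    then show ?thesis using n by simp
  qed
qed

text \<open>The commutation clauses of the two roots, used one after the other, make the roots
  \<open>q\<close> and \<open>r\<close> commute, so that the product is the square of
  \<open>q \<otimes> r\<close>.\<close>

lemma pos_mult:
  assumes g: "g \<in> pos" and h: "h \<in> pos" and gh: "g \<otimes> h = h \<otimes> g"
  shows "g \<otimes> h \<in> pos"
proof -
  obtain q where q: "q \<in> sa A" "q \<otimes> q = g" 
    "\<And>x. \<lbrakk>x \<in> carrier A; x \<otimes> g = g \<otimes> x\<rbrakk> \<Longrightarrow> x \<otimes> q = q \<otimes> x" using pos_sqrt[OF g] pos_sa by metis
  obtain r where r: "r \<in> sa A" "r \<otimes> r = h" 
    "\<And>x. \<lbrakk>x \<in> carrier A; x \<otimes> h = h \<otimes> x\<rbrakk> \<Longrightarrow> x \<otimes> r = r \<otimes> x" using pos_sqrt[OF h] pos_sa by metis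
  have c: "q \<in> carrier A" "r \<in> carrier A" using q r by (auto simp: sa_iff)
  have qr: "q \<otimes> r = r \<otimes> q" using q(3)[of h] r(3)[of q] c gh pos_carrier[OF h] by simp
  have "(q \<otimes> r) \<otimes> (q \<otimes> r) = q \<otimes> (r \<otimes> q) \<otimes> r" using c by (simp add: m_assoc)
  also have "\<dots> = g \<otimes> h" using c by (simp add: m_assoc flip: qr q(2) r(2))
  finally show ?thesis using square_pos[OF sa_mult[OF q(1) r(1) qr]] by simp
qed

text \<open>With commuting roots \<open>k\<close> of \<open>g\<close> and \<open>l\<close> of
  \<open>t - g\<close> one has \<open>k k + l l = t\<close>, so
  \<open>nrm_sq_le_of_square_sum\<close> bounds the squared norm of \<open>k\<close>, which is the
  norm of \<open>g\<close>. That \<open>t\<close> is nonnegative follows as \<open>t\<close> is a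
  sum of two positive elements.\<close>

lemma nrm_le_of_pos:
  assumes g: "g \<in> pos" and tg: "complex_of_real t \<odot> \<one> \<ominus> g \<in> pos"
  shows "nrm A g \<le> t"
proof -
  let ?g' = "complex_of_real t \<odot> \<one> \<ominus> g"
  have gc [simp]: "g \<in> carrier A" using g by (rule pos_carrier)
  have sum: "g \<oplus> ?g' = complex_of_real t \<odot> \<one>"
    using gc smult_in_carrier[OF one_closed, of "complex_of_real t"] by algebra
  have t: "0 \<le> t" using pos_add[OF g tg] unfolding sum scalar_pos_iff .
  obtain k where k: "k \<in> sa A" "k \<otimes> k = g" 
    "\<And>x. \<lbrakk>x \<in> carrier A; x \<otimes> g = g \<otimes> x\<rbrakk> \<Longrightarrow> x \<otimes> k = k \<otimes> x" using pos_sqrt[OF g] pos_sa by metis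
  obtain l where l: "l \<in> sa A" "l \<otimes> l = ?g'" 
    "\<And>x. \<lbrakk>x \<in> carrier A; x \<otimes> ?g' = ?g' \<otimes> x\<rbrakk> \<Longrightarrow> x \<otimes> l = l \<otimes> x" using pos_sqrt[OF tg] pos_sa by metis
  have kc: "k \<in> carrier A" using k(1) by (rule sa_carrier)
  have "g \<otimes> k = k \<otimes> g" using k(3)[of g] by simp
  then have "k \<otimes> l = l \<otimes> k"
    using kc by (intro l(3)) (simp_all add: a_minus_def r_distr l_distr r_minus l_minus)
  then have "(nrm A k)\<^sup>2 \<le> t" using nrm_sq_le_of_square_sum[OF k(1) l(1) _ _ t] sum k l by simp
  then show ?thesis using nrm_sa_square[OF k(1)] k(2) by simp
qed

lemma nrm_mono_pos:
  assumes x: "x \<in> pos" and y: "y \<in> sa A" and xy: "y \<ominus> x \<in> pos"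
  shows "nrm A x \<le> nrm A y"
proof (rule nrm_le_of_pos[OF x])
  let ?n = "complex_of_real (nrm A y) \<odot> \<one>"
  have "?n \<ominus> x = (?n \<ominus> y) \<oplus> (y \<ominus> x)"
    using pos_carrier[OF x] sa_carrier[OF y] smult_in_carrier[OF one_closed, of "complex_of_real (nrm A y)"]
    by algebra
  then show "?n \<ominus> x \<in> pos" using pos_add[OF pos_nrm_diff[OF y order.refl] xy] by simp
qed

section \<open>Real and imaginary parts, and positivity of
  \<open>adj A a \<otimes> a\<close>\<close>

definition re_part :: "'a \<Rightarrow> 'a" where "re_part c = (1/2) \<odot> (c \<oplus> adj A c)"
definition im_part :: "'a \<Rightarrow> 'a" where "im_part c = (- \<i>/2) \<odot> (c \<ominus> adj A c)"

lemma re_part_sa [simp]: "c \<in> carrier A \<Longrightarrow> re_part c \<in> sa A"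
  by (simp add: sa_iff re_part_def a_comm)

lemma im_part_sa [simp]: "c \<in> carrier A \<Longrightarrow> im_part c \<in> sa A"
  by (simp add: sa_iff im_part_def smult_add_right smult_minus_right smult_minus_left a_minus_def
      minus_add a_comm)

lemma re_im_decomp: "c \<in> carrier A \<Longrightarrow> c = re_part c \<oplus> \<i> \<odot> im_part c"
proof -
  assume c: "c \<in> carrier A"
  have "re_part c \<oplus> \<i> \<odot> im_part c = (1/2) \<odot> ((c \<oplus> adj A c) \<oplus> (c \<ominus> adj A c))"
    using c by (simp add: re_part_def im_part_def smult_add_right)
  also have "(c \<oplus> adj A c) \<oplus> (c \<ominus> adj A c) = 2 \<odot> c"
    unfolding two_smult[OF c] using c adj_closed[OF c] by algebra
  finally show ?thesis using c by simp
qed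

text \<open>The mixed terms cancel and leave twice the sum of the squares of the real and imaginary
  parts. Thus the sum is positive before either summand is known to be.\<close>

lemma mult_adj_plus_adj_mult_pos:
  assumes c: "c \<in> carrier A" shows "adj A c \<otimes> c \<oplus> c \<otimes> adj A c \<in> pos"
proof -
  define x v where "x = re_part c" and "v = \<i> \<odot> im_part c"
  have xc [simp]: "x \<in> carrier A" "adj A x = x" and y: "im_part c \<in> carrier A" "adj A (im_part c) = im_part c"
    using re_part_sa[OF c] im_part_sa[OF c] by (simp_all add: x_def sa_iff)
  have vc [simp]: "v \<in> carrier A" "adj A v = \<ominus> v" by (simp_all add: v_def y smult_minus_left)
  have vv: "\<ominus> (v \<otimes> v) = im_part c \<otimes> im_part c" by (simp add: v_def y smult_minus_left)
  have c_eq: "c = x \<oplus> v" unfolding x_def v_def by (rule re_im_decomp[OF c])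
  have "adj A c \<otimes> c \<oplus> c \<otimes> adj A c
      = (x \<otimes> x \<oplus> x \<otimes> x) \<oplus> (\<ominus> (v \<otimes> v) \<oplus> \<ominus> (v \<otimes> v))"
    unfolding c_eq by (simp, use xc(1) vc(1) in algebra)
  also have "\<dots> \<in> pos"
    unfolding vv using re_part_sa[OF c] im_part_sa[OF c]
    by (intro pos_add square_pos) (auto simp: x_def)
  finally show ?thesis .
qed

text \<open>With \<open>q = - c\<^sup>* c\<close> one has \<open>(1 + q)\<^sup>n q = - c\<^sup>* (1 - c c\<^sup>*)\<^sup>n c\<close>, which stays bounded
  because \<open>c c\<^sup>*\<close> is positive, whereas positivity of \<open>q\<close> makes the left side at least \<open>n q\<^sup>2\<close>.\<close>

lemma neg_adj_mult_pos_nrm_le_1: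
  assumes c: "c \<in> carrier A" and c1: "nrm A c \<le> 1" and q: "\<ominus> (adj A c \<otimes> c) \<in> pos"
  shows "c = \<zero>"
proof -
  define q where "q = \<ominus> (adj A c \<otimes> c)"
  define p where "p = c \<otimes> adj A c"
  note [simp] = c
  have qp: "q \<in> pos" using assms(3) by (simp add: q_def)
  have qc [simp]: "q \<in> carrier A" and pc [simp]: "p \<in> carrier A" by (simp_all add: q_def p_def)
  have "p = (adj A c \<otimes> c \<oplus> c \<otimes> adj A c) \<oplus> q"
    unfolding p_def q_def using c adj_closed[OF c] by algebra
  then have pp: "p \<in> pos" using pos_add[OF mult_adj_plus_adj_mult_pos[OF c] qp] by simp
  have "nrm A p \<le> nrm A c * nrm A c" unfolding p_def using nrm_mult[of c "adj A c"] by simp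
  also have "\<dots> \<le> 1" using c1 by (simp add: mult_le_one)
  finally have p1: "\<one> \<ominus> p \<in> pos" using pos_nrm_diff[OF pos_sa[OF pp], of 1] by simp
  have "\<one> \<ominus> (\<one> \<ominus> p) = p" using one_closed pc by algebra
  then have e1: "nrm A (\<one> \<ominus> p) \<le> 1" using nrm_le_of_pos[OF p1, of 1] pp by simp
  \<comment> \<open>\<open>W n\<close> is the \<open>n\<close>-th power of \<open>1 - p\<close>, of
    norm at most 1 because both \<open>p\<close> and \<open>1 - p\<close> are positive.\<close>
  define W where "W = rec_nat \<one> (\<lambda>_ w. (\<one> \<ominus> p) \<otimes> w)"
  have W0: "W 0 = \<one>" and WS: "W (Suc n) = (\<one> \<ominus> p) \<otimes> W n" for n by (simp_all add: W_def)
  have Wc [simp]: "W n \<in> carrier A" for n by (induction n) (simp_all add: W0 WS)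
  have W1: "nrm A (W n) \<le> 1" for n
  proof (induction n)
    case (Suc n)
    have "nrm A (W (Suc n)) \<le> nrm A (\<one> \<ominus> p) * nrm A (W n)"
      unfolding WS by (intro nrm_mult) auto
    also have "\<dots> \<le> 1" using Suc e1 by (intro mult_le_one) auto
    finally show ?case .
  qed (simp add: W0)
  \<comment> \<open>\<open>Z n\<close> is the \<open>n\<close>-th power of \<open>1 + q\<close>
    times \<open>q\<close>.\<close>
  define Z where "Z = rec_nat q (\<lambda>_ z. (\<one> \<oplus> q) \<otimes> z)"
  have Z0: "Z 0 = q" and ZS: "Z (Suc n) = (\<one> \<oplus> q) \<otimes> Z n" for n by (simp_all add: Z_def)
  have ZW: "Z n = \<ominus> (adj A c \<otimes> (W n \<otimes> c))" for n
  proof (induction n)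
    case (Suc n)
    \<comment> \<open>This intertwining relation moves the powers of \<open>1 + q\<close> across
      \<open>adj A c\<close>, where they turn into powers of \<open>1 - p\<close>.\<close>
    have "(\<one> \<oplus> q) \<otimes> adj A c = adj A c \<otimes> (\<one> \<ominus> p)"
      by (simp add: q_def p_def a_minus_def l_distr r_distr l_minus r_minus m_assoc)
    then have "(\<one> \<oplus> q) \<otimes> adj A c \<otimes> (W n \<otimes> c) = adj A c \<otimes> (\<one> \<ominus> p) \<otimes> (W n \<otimes> c)" by simp
    then have "(\<one> \<oplus> q) \<otimes> (adj A c \<otimes> (W n \<otimes> c)) = adj A c \<otimes> (W (Suc n) \<otimes> c)"
      by (simp add: WS m_assoc)
    then show ?case by (simp add: ZS Suc r_minus)
  qed (simp add: Z0 W0 q_def)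
  have Z1: "nrm A (Z n) \<le> 1" for n
  proof -
    have "nrm A (Z n) \<le> nrm A c * (nrm A (W n) * nrm A c)"
      unfolding ZW using nrm_mult[of "adj A c" "W n \<otimes> c"] nrm_mult[of "W n" c]
      by (simp, smt (verit) mult_left_mono nrm_nonneg c)
    also have "\<dots> \<le> 1" using c1 W1[of n] by (intro mult_le_one) auto
    finally show ?thesis .
  qed
  have m_pos: "complex_of_real (real n) \<odot> (q \<otimes> q) \<in> pos" for n
    by (intro pos_smult pos_mult qp) auto
  \<comment> \<open>\<open>d\<close> collects the terms of the binomial expansion of degree at least
    3 in \<open>q\<close>. It must commute with \<open>q\<close> for \<open>q \<otimes> d\<close> to
    be positive in the next step.\<close>
  have decomp: "\<exists>d\<in>pos. q \<otimes> d = d \<otimes> q \<and> Z n = q \<oplus> d \<oplus> complex_of_real (real n) \<odot> (q \<otimes> q)" for n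
  proof (induction n)
    case 0
    then show ?case by (auto simp: Z0 pos_zero intro!: bexI[of _ \<zero>])
  next
    case (Suc n)
    define m where "m = complex_of_real (real n) \<odot> (q \<otimes> q)"
    have m: "m \<in> pos" using m_pos by (simp add: m_def)
    have mc [simp]: "m \<in> carrier A" using m by (rule pos_carrier)
    have qm: "q \<otimes> m = m \<otimes> q" by (simp add: m_def m_assoc)
    obtain d where d: "d \<in> pos" "q \<otimes> d = d \<otimes> q" "Z n = q \<oplus> d \<oplus> m"
      using Suc by (auto simp: m_def)
    have dc [simp]: "d \<in> carrier A" using d(1) by (rule pos_carrier)
    define d' where "d' = d \<oplus> q \<otimes> d \<oplus> q \<otimes> m"
    have "d' \<in> pos" unfolding d'_def by (intro pos_add pos_mult d qp m qm)
    moreover have "q \<otimes> d' = d' \<otimes> q" by (simp add: d'_def r_distr l_distr m_assoc flip: d(2) qm)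
    moreover have "Z (Suc n) = q \<oplus> d' \<oplus> (m \<oplus> q \<otimes> q)"
      unfolding ZS d(3) d'_def by (simp add: l_distr r_distr a_ac)
    moreover have "m \<oplus> q \<otimes> q = complex_of_real (real (Suc n)) \<odot> (q \<otimes> q)"
      using smult_add_left[of "q \<otimes> q" "of_nat n" 1] by (simp add: m_def add.commute)
    ultimately show ?case by auto
  qed
  have bound: "real n * (nrm A q)\<^sup>2 \<le> 1" for n
  proof -
    let ?m = "complex_of_real (real n) \<odot> (q \<otimes> q)"
    obtain d where d: "d \<in> pos" "Z n = q \<oplus> d \<oplus> ?m" using decomp[of n] by blast
    have "Z n \<in> pos" unfolding d(2) by (intro pos_add qp d m_pos)
    moreover have "Z n \<ominus> ?m \<in> pos"
      using pos_add[OF qp d(1)] pos_carrier[OF d(1)] unfolding d(2)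
      by (simp add: a_minus_def a_assoc r_neg)
    ultimately have "nrm A ?m \<le> nrm A (Z n)" by (intro nrm_mono_pos m_pos pos_sa)
    then show ?thesis using Z1[of n] nrm_sa_square[OF pos_sa[OF qp]] by (simp add: nrm_smult)
  qed
  have "nrm A q = 0"
  proof (rule ccontr)
    assume "nrm A q \<noteq> 0"
    then obtain n :: nat where "1 < real n * (nrm A q)\<^sup>2"
      using reals_Archimedean3[of "(nrm A q)\<^sup>2"] by auto
    then show False using bound[of n] by simp
  qed
  then have "(nrm A c)\<^sup>2 = 0" using nrm_cstar[OF c] by (simp add: q_def)
  then show ?thesis by (simp add: nrm_eq_0)
qed

lemma neg_adj_mult_pos:
  assumes c: "c \<in> carrier A" and q: "\<ominus> (adj A c \<otimes> c) \<in> pos"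
  shows "c = \<zero>"
proof (rule ccontr)
  assume "c \<noteq> \<zero>"
  then have n: "nrm A c > 0" using nrm_eq_0[OF c] nrm_nonneg[OF c] by linarith
  define r where "r = 1 / nrm A c"
  define c' where "c' = complex_of_real r \<odot> c"
  have c': "c' \<in> carrier A" "nrm A c' = 1" using c n by (simp_all add: c'_def r_def nrm_smult norm_divide)
  have "\<ominus> (adj A c' \<otimes> c') = complex_of_real (r * r) \<odot> (\<ominus> (adj A c \<otimes> c))"
    using c by (simp add: c'_def smult_minus_right)
  also have "\<dots> \<in> pos" by (intro pos_smult q) simp
  finally have "c' = \<zero>" using neg_adj_mult_pos_nrm_le_1[of c'] c' by simp
  then show False using c'(2) by simp
qed

text \<open>For \<open>h = a\<^sup>* a\<close> and \<open>k = |h|\<close> the element \<open>c = a (k - h)\<close> has \<open>c\<^sup>* c \<le> 0\<close>, since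
  \<open>k - h\<close> is twice the negative part of \<open>h\<close>.\<close>

lemma adj_mult_pos:
  assumes a [simp]: "a \<in> carrier A" shows "adj A a \<otimes> a \<in> pos"
proof -
  define h where "h = adj A a \<otimes> a"
  have hs: "h \<in> sa A" unfolding h_def by (rule sa_adj_mult) simp
  have hc [simp]: "h \<in> carrier A" "adj A h = h" using hs by (auto simp: sa_iff)
  obtain k where k: "k \<in> pos" "k \<otimes> k = h \<otimes> h"
    "\<And>x. \<lbrakk>x \<in> carrier A; x \<otimes> (h \<otimes> h) = h \<otimes> h \<otimes> x\<rbrakk> \<Longrightarrow> x \<otimes> k = k \<otimes> x"
    using pos_sqrt[OF square_pos[OF hs]] by blast
  have kc [simp]: "k \<in> carrier A" "adj A k = k" using pos_sa[OF k(1)] by (auto simp: sa_iff)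
  have hk: "h \<otimes> k = k \<otimes> h" using k(3)[of h] by (simp add: m_assoc)
  define d where "d = k \<ominus> h"
  have dc [simp]: "d \<in> carrier A" "adj A d = d" by (simp_all add: d_def)
  have dk: "d \<otimes> k = k \<otimes> d" by (simp add: d_def a_minus_def l_distr r_distr l_minus r_minus hk)
  \<comment> \<open>The root of \<open>k\<close> turns \<open>k \<otimes> d \<otimes> d\<close> into
    the square of the self-adjoint element \<open>m \<otimes> d\<close>.\<close>
  obtain m where m: "m \<in> pos" "m \<otimes> m = k"
    "\<And>x. \<lbrakk>x \<in> carrier A; x \<otimes> k = k \<otimes> x\<rbrakk> \<Longrightarrow> x \<otimes> m = m \<otimes> x"
    using pos_sqrt[OF k(1)] by blast
  have mc [simp]: "m \<in> carrier A" using m(1) by (rule pos_carrier)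
  have md: "m \<otimes> d = d \<otimes> m" using m(3)[OF dc(1) dk] by simp
  have mds: "m \<otimes> d \<in> sa A" using md pos_sa[OF m(1)] by (intro sa_mult) (auto simp: sa_iff)
  \<comment> \<open>Here \<open>k \<otimes> k = h \<otimes> h\<close> enters: together with
    \<open>hk\<close> it gives \<open>d (k + h) = 0\<close>, equivalently
    \<open>d d = 2 k d\<close>.\<close>
  have "d \<otimes> d = (k \<otimes> k \<ominus> k \<otimes> h) \<oplus> (h \<otimes> h \<ominus> h \<otimes> k)"
    unfolding d_def using kc(1) hc(1) by algebra
  also have "\<dots> = (k \<otimes> k \<ominus> k \<otimes> h) \<oplus> (k \<otimes> k \<ominus> k \<otimes> h)"
    by (simp add: k(2) hk)
  also have "k \<otimes> k \<ominus> k \<otimes> h = k \<otimes> d" unfolding d_def using kc(1) hc(1) by algebra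
  finally have dd: "d \<otimes> d = k \<otimes> d \<oplus> k \<otimes> d" .
  have h_eq: "h = k \<ominus> d" unfolding d_def using kc(1) hc(1) by algebra
  \<comment> \<open>As \<open>d\<close> commutes with \<open>k\<close>, this product is
    \<open>k d d - 2 k d d\<close>, the negative of a square.\<close>
  have "d \<otimes> (h \<otimes> d) = d \<otimes> k \<otimes> d \<ominus> d \<otimes> d \<otimes> d"
    unfolding h_eq using kc(1) dc(1) by algebra
  also have "\<dots> = \<ominus> (k \<otimes> d \<otimes> d)"
    unfolding dd dk using kc(1) dc(1) by algebra
  also have "k \<otimes> d \<otimes> d = m \<otimes> (d \<otimes> m) \<otimes> d"
    by (simp add: m_assoc flip: m(2) md)
  also have "\<dots> = (m \<otimes> d) \<otimes> (m \<otimes> d)" by (simp add: m_assoc)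
  finally have dhd: "\<ominus> (d \<otimes> (h \<otimes> d)) = (m \<otimes> d) \<otimes> (m \<otimes> d)" by simp
  have "adj A (a \<otimes> d) \<otimes> (a \<otimes> d) = d \<otimes> (h \<otimes> d)" by (simp add: h_def m_assoc)
  then have "\<ominus> (adj A (a \<otimes> d) \<otimes> (a \<otimes> d)) = (m \<otimes> d) \<otimes> (m \<otimes> d)" using dhd by simp
  then have "a \<otimes> d = \<zero>" using neg_adj_mult_pos[of "a \<otimes> d"] square_pos[OF mds] by simp
  \<comment> \<open>From \<open>a d = 0\<close> the factors are peeled off in turn:
    \<open>m d\<close>, then \<open>k d = m m d\<close>, then \<open>d d = 2 k d\<close>, and
    finally \<open>d\<close> vanish.\<close>
  then have "(m \<otimes> d) \<otimes> (m \<otimes> d) = \<zero>"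
    using dhd by (simp add: h_def m_assoc)
  then have "m \<otimes> d = \<zero>"
    using nrm_sa_square[OF mds] by (simp add: nrm_eq_0)
  then have "k \<otimes> d = \<zero>" by (simp add: m_assoc flip: m(2))
  then have "d \<otimes> d = \<zero>" using dd by simp
  then have "d = \<zero>"
    using nrm_sa_square[of d] by (simp add: nrm_eq_0 sa_iff)
  then have "h = k" by (simp add: h_eq a_minus_def)
  then show ?thesis using k(1) by (simp add: h_def)
qed

end


section \<open>Existence of states\<close>

context unital_cstar_algebra
begin

text \<open>As \<open>\<one>\<close> is an order unit for \<open>pos\<close>, a cone containing
  \<open>\<ominus> \<one>\<close> would be all of \<open>sa A\<close>; the last clause is thus
  properness in a form that survives unions of chains.\<close>

definition proper_cone :: "'a set \<Rightarrow> bool" where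
  "proper_cone K \<longleftrightarrow> pos \<subseteq> K \<and> K \<subseteq> sa A \<and> (\<forall>x\<in>K. \<forall>y\<in>K. x \<oplus> y \<in> K) \<and>
     (\<forall>r\<ge>0. \<forall>x\<in>K. complex_of_real r \<odot> x \<in> K) \<and> \<ominus> \<one> \<notin> K"

lemma proper_coneD:
  assumes "proper_cone K"
  shows "h \<in> pos \<Longrightarrow> h \<in> K" "x \<in> K \<Longrightarrow> x \<in> sa A" "x \<in> K \<Longrightarrow> x \<in> carrier A"
    "\<lbrakk>x \<in> K; y \<in> K\<rbrakk> \<Longrightarrow> x \<oplus> y \<in> K" "\<lbrakk>0 \<le> r; x \<in> K\<rbrakk> \<Longrightarrow> complex_of_real r \<odot> x \<in> K"
    "\<ominus> \<one> \<notin> K"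
  using assms by (auto simp: proper_cone_def sa_iff)

lemma proper_cone_scalar:
  assumes K: "proper_cone K" and r: "complex_of_real r \<odot> \<one> \<in> K" shows "0 \<le> r"
proof (rule ccontr)
  assume "\<not> 0 \<le> r"
  then have "0 \<le> - 1 / r" by (simp add: divide_nonpos_neg)
  then have "complex_of_real (- 1 / r) \<odot> (complex_of_real r \<odot> \<one>) \<in> K"
    using r by (rule proper_coneD(5)[OF K])
  moreover have "complex_of_real (- 1 / r) \<odot> (complex_of_real r \<odot> \<one>) = \<ominus> \<one>"
    using \<open>\<not> 0 \<le> r\<close> by (simp add: smult_minus_left)
  ultimately show False using proper_coneD(6)[OF K] by simp
qed

lemma pos_proper_cone: "proper_cone pos"
  using scalar_pos_iff[of "-1"] by (auto simp: proper_cone_def pos_sa pos_add pos_smult smult_minus_left)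

text \<open>Adjoin the ray through \<open>x\<close>. If \<open>-1 = m + r x\<close> with
  \<open>m\<close> in \<open>K\<close>, then either \<open>r = 0\<close> and \<open>-1\<close> lies
  in \<open>K\<close>, or \<open>-x = (m + 1) / r\<close> lies in \<open>K\<close>; both are
  excluded.\<close>

lemma proper_cone_extend:
  assumes K: "proper_cone K" and x: "x \<in> sa A" and nx: "\<ominus> x \<notin> K"
  obtains K' where "proper_cone K'" "K \<subseteq> K'" "x \<in> K'"
proof
  let ?K = "{m \<oplus> complex_of_real r \<odot> x |m r. m \<in> K \<and> 0 \<le> r}"
  note KD = proper_coneD[OF K]
  have xc [simp]: "x \<in> carrier A" using x by (rule sa_carrier)
  have zero: "\<zero> \<in> K" using KD(1) pos_zero by blast
  show sub: "K \<subseteq> ?K"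
  proof
    fix m assume m: "m \<in> K"
    then have "m = m \<oplus> complex_of_real 0 \<odot> x" using KD(3) by simp
    then show "m \<in> ?K" using m by blast
  qed
  have "x = \<zero> \<oplus> complex_of_real 1 \<odot> x" by simp
  then show "x \<in> ?K" using zero by (blast intro: zero_le_one)
  show "proper_cone ?K"
    unfolding proper_cone_def
  proof (intro conjI ballI allI impI)
    show "pos \<subseteq> ?K" using sub KD(1) by blast
    show "?K \<subseteq> sa A" using KD(2) x by (auto intro!: sa_add sa_smult)
    show "y \<oplus> z \<in> ?K" if yz: "y \<in> ?K" "z \<in> ?K" for y z
    proof -
      obtain m r where y: "y = m \<oplus> complex_of_real r \<odot> x" "m \<in> K" "0 \<le> r" using yz(1) by blast
      obtain n s where z: "z = n \<oplus> complex_of_real s \<odot> x" "n \<in> K" "0 \<le> s" using yz(2) by blast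
      have "y \<oplus> z = (m \<oplus> n) \<oplus> complex_of_real (r + s) \<odot> x"
        using y z KD(3) by (simp add: smult_add_left a_ac)
      then show ?thesis using y z KD(4) by (blast intro: add_nonneg_nonneg)
    qed
    show "complex_of_real s \<odot> y \<in> ?K" if s: "0 \<le> s" and y: "y \<in> ?K" for s y
    proof -
      obtain m r where y: "y = m \<oplus> complex_of_real r \<odot> x" "m \<in> K" "0 \<le> r" using y by blast
      have "complex_of_real s \<odot> y = complex_of_real s \<odot> m \<oplus> complex_of_real (s * r) \<odot> x"
        using y KD(3) by (simp add: smult_add_right)
      then show ?thesis using y s KD(5) by (blast intro: mult_nonneg_nonneg)
    qed
    show "\<ominus> \<one> \<notin> ?K"
    proof
      assume "\<ominus> \<one> \<in> ?K"
      then obtain m r where m: "\<ominus> \<one> = m \<oplus> complex_of_real r \<odot> x" "m \<in> K" "0 \<le> r" by blast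
      have mc [simp]: "m \<in> carrier A" using KD(3) m(2) .
      have "r \<noteq> 0"
      proof
        assume "r = 0"
        then have "\<ominus> \<one> = m" using m(1) by simp
        then show False using KD(6) m(2) by blast
      qed
      have "\<ominus> (complex_of_real r \<odot> x) = m \<ominus> \<ominus> \<one>"
        unfolding m(1) using mc smult_in_carrier[OF xc, of "complex_of_real r"] by algebra
      then have "\<ominus> (complex_of_real r \<odot> x) = m \<oplus> \<one>" by (simp add: a_minus_def)
      moreover have "complex_of_real (1 / r) \<odot> (m \<oplus> \<one>) \<in> K"
        using m(2,3) KD(1)[OF pos_one] by (intro KD(4,5)) auto
      ultimately have "complex_of_real (1 / r) \<odot> (\<ominus> (complex_of_real r \<odot> x)) \<in> K" by simp
      then show False using nx \<open>r \<noteq> 0\<close> by (simp add: smult_minus_right)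
    qed
  qed
qed

text \<open>By Zorn's lemma there is a maximal proper cone above \<open>K\<close>, and
  \<open>proper_cone_extend\<close> shows that it misses \<open>x\<close> only if it contains
  \<open>\<ominus> x\<close>.\<close>

lemma ex_total_proper_cone:
  assumes K: "proper_cone K"
  obtains M where "proper_cone M" "K \<subseteq> M" "\<And>x. x \<in> sa A \<Longrightarrow> x \<in> M \<or> \<ominus> x \<in> M"
proof -
  define S where "S = {M. proper_cone M \<and> K \<subseteq> M}"
  have "\<exists>M\<in>S. \<forall>Y\<in>S. M \<subseteq> Y \<longrightarrow> Y = M"
  proof (rule subset_Zorn_nonempty)
    show "S \<noteq> {}" using K by (auto simp: S_def)
    fix \<C> assume ne: "\<C> \<noteq> {}" and ch: "subset.chain S \<C>"
    have pc: "proper_cone Y" and KX: "K \<subseteq> Y" if "Y \<in> \<C>" for Y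
      using ch that unfolding subset.chain_def S_def by blast+
    have join: "\<exists>Z\<in>\<C>. x \<in> Z \<and> y \<in> Z" if "x \<in> Y" "Y \<in> \<C>" "y \<in> Z'" "Z' \<in> \<C>" for x y Y Z'
      using ch that unfolding subset_chain_def by blast
    have "proper_cone (\<Union>\<C>)"
      unfolding proper_cone_def
    proof (intro conjI ballI allI impI)
      show "pos \<subseteq> \<Union>\<C>" using ne proper_coneD(1)[OF pc] by blast
      show "\<Union>\<C> \<subseteq> sa A" using proper_coneD(2)[OF pc] by blast
      show "x \<oplus> y \<in> \<Union>\<C>" if xy: "x \<in> \<Union>\<C>" "y \<in> \<Union>\<C>" for x y
      proof -
        obtain Z where "Z \<in> \<C>" "x \<in> Z" "y \<in> Z" using xy join by blast
        then show ?thesis using proper_coneD(4)[OF pc] by blast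
      qed
      show "complex_of_real r \<odot> x \<in> \<Union>\<C>" if "0 \<le> r" "x \<in> \<Union>\<C>" for r x
        using that proper_coneD(5)[OF pc] by blast
      show "\<ominus> \<one> \<notin> \<Union>\<C>" using proper_coneD(6)[OF pc] by blast
    qed
    then show "\<Union>\<C> \<in> S" using ne KX by (auto simp: S_def)
  qed
  then obtain M where M: "proper_cone M" "K \<subseteq> M"
    and max: "\<And>Y. \<lbrakk>proper_cone Y; K \<subseteq> Y; M \<subseteq> Y\<rbrakk> \<Longrightarrow> Y = M" by (auto simp: S_def)
  have "x \<in> M \<or> \<ominus> x \<in> M" if x: "x \<in> sa A" for x
  proof (rule disjCI)
    assume "\<ominus> x \<notin> M"
    then obtain K' where "proper_cone K'" "M \<subseteq> K'" "x \<in> K'"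
      using proper_cone_extend[OF M(1) x] by blast
    then show "x \<in> M" using max[of K'] M(2) by blast
  qed
  then show ?thesis using that M by blast
qed

text \<open>A total proper cone cuts the self-adjoint part at each \<open>x\<close>: \<open>v\<close> is the value at \<open>x\<close> of the
  functional that the cone defines.\<close>

definition cut_value :: "'a set \<Rightarrow> 'a \<Rightarrow> real \<Rightarrow> bool" where
  "cut_value M x v \<longleftrightarrow> (\<forall>t<v. x \<ominus> complex_of_real t \<odot> \<one> \<in> M) \<and>
     (\<forall>t>v. complex_of_real t \<odot> \<one> \<ominus> x \<in> M)"

lemma cut_valueD:
  assumes "cut_value M x v"
  shows "t < v \<Longrightarrow> x \<ominus> complex_of_real t \<odot> \<one> \<in> M"
    and "v < t \<Longrightarrow> complex_of_real t \<odot> \<one> \<ominus> x \<in> M"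
  using assms by (auto simp: cut_value_def)

lemma cut_value_unique_le:
  assumes M: "proper_cone M" and x: "x \<in> carrier A"
    and v: "cut_value M x v" and w: "cut_value M x w"
  shows "v \<le> w"
proof (rule ccontr)
  assume "\<not> v \<le> w"
  then obtain t s where ts: "w < t" "t < s" "s < v" by (meson dense not_le)
  have "x \<ominus> complex_of_real s \<odot> \<one> \<in> M" "complex_of_real t \<odot> \<one> \<ominus> x \<in> M"
    using v w ts by (auto simp: cut_value_def)
  then have "(x \<ominus> complex_of_real s \<odot> \<one>) \<oplus> (complex_of_real t \<odot> \<one> \<ominus> x) \<in> M"
    by (rule proper_coneD(4)[OF M])
  also have "(x \<ominus> complex_of_real s \<odot> \<one>) \<oplus> (complex_of_real t \<odot> \<one> \<ominus> x)
      = complex_of_real t \<odot> \<one> \<ominus> complex_of_real s \<odot> \<one>"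
    using x smult_in_carrier[OF one_closed, of "complex_of_real s"]
      smult_in_carrier[OF one_closed, of "complex_of_real t"] by algebra
  also have "\<dots> = complex_of_real (t - s) \<odot> \<one>" by (simp add: smult_diff_left)
  finally show False using proper_cone_scalar[OF M] ts(2) by fastforce
qed

lemma cut_value_unique:
  "\<lbrakk>proper_cone M; x \<in> carrier A; cut_value M x v; cut_value M x w\<rbrakk> \<Longrightarrow> v = w"
  by (meson cut_value_unique_le order.antisym)

text \<open>The value is the supremum of the lower part \<open>D\<close>. Since
  \<open>\<one>\<close> is an order unit, \<open>D\<close> contains minus the norm of
  \<open>x\<close> and is bounded above by the norm.\<close>

lemma ex_cut_value:
  assumes M: "proper_cone M" and tot: "\<And>x. x \<in> sa A \<Longrightarrow> x \<in> M \<or> \<ominus> x \<in> M"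
    and x: "x \<in> sa A"
  shows "\<exists>v. cut_value M x v"
proof -
  have xc [simp]: "x \<in> carrier A" using x by (rule sa_carrier)
  have sc: "complex_of_real t \<odot> \<one> \<in> carrier A" for t by simp
  define D where "D = {t. x \<ominus> complex_of_real t \<odot> \<one> \<in> M}"
  have mono: "s \<in> D" if "t \<in> D" "s \<le> t" for s t
  proof -
    have "(x \<ominus> complex_of_real t \<odot> \<one>) \<oplus> complex_of_real (t - s) \<odot> \<one> \<in> M"
      using that proper_coneD(1)[OF M] scalar_pos_iff[of "t - s"]
      by (intro proper_coneD(4)[OF M]) (auto simp: D_def)
    also have "(x \<ominus> complex_of_real t \<odot> \<one>) \<oplus> complex_of_real (t - s) \<odot> \<one>
        = (x \<ominus> complex_of_real t \<odot> \<one>) \<oplus> (complex_of_real t \<odot> \<one> \<ominus> complex_of_real s \<odot> \<one>)"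
      by (simp add: smult_diff_left)
    also have "\<dots> = x \<ominus> complex_of_real s \<odot> \<one>" using xc sc[of s] sc[of t] by algebra
    finally show ?thesis by (simp add: D_def)
  qed
  have bdd: "t \<le> nrm A x" if "t \<in> D" for t
  proof -
    have "(x \<ominus> complex_of_real t \<odot> \<one>) \<oplus> (complex_of_real (nrm A x) \<odot> \<one> \<ominus> x) \<in> M"
      using that proper_coneD(1)[OF M] pos_nrm_diff[OF x order.refl]
      by (intro proper_coneD(4)[OF M]) (auto simp: D_def)
    also have "(x \<ominus> complex_of_real t \<odot> \<one>) \<oplus> (complex_of_real (nrm A x) \<odot> \<one> \<ominus> x)
        = complex_of_real (nrm A x) \<odot> \<one> \<ominus> complex_of_real t \<odot> \<one>"
      using xc sc[of t] sc[of "nrm A x"] by algebra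
    also have "\<dots> = complex_of_real (nrm A x - t) \<odot> \<one>" by (simp add: smult_diff_left)
    finally show ?thesis using proper_cone_scalar[OF M] by fastforce
  qed
  have "x \<ominus> complex_of_real (- nrm A x) \<odot> \<one> = complex_of_real (nrm A x) \<odot> \<one> \<ominus> (\<ominus> x)"
    by (simp add: smult_minus_left a_minus_def a_comm)
  also have "\<dots> \<in> M" using x by (intro proper_coneD(1)[OF M] pos_nrm_diff) auto
  finally have ne: "- nrm A x \<in> D" by (simp add: D_def)
  have bd: "bdd_above D" using bdd by (auto simp: bdd_above_def)
  have "cut_value M x (Sup D)"
    unfolding cut_value_def
  proof (intro conjI allI impI)
    fix t assume "t < Sup D"
    then obtain s where "s \<in> D" "t < s" using less_cSup_iff[OF _ bd] ne by blast
    then show "x \<ominus> complex_of_real t \<odot> \<one> \<in> M" using mono[of s t] by (simp add: D_def)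
  next
    fix t assume "t > Sup D"
    then have "t \<notin> D" using cSup_upper[OF _ bd] by force
    \<comment> \<open>Totality of the cone leaves no gap above the supremum.\<close>
    then have "\<ominus> (x \<ominus> complex_of_real t \<odot> \<one>) \<in> M"
      using tot[of "x \<ominus> complex_of_real t \<odot> \<one>"] x by (auto simp: D_def)
    then show "complex_of_real t \<odot> \<one> \<ominus> x \<in> M" by (simp add: a_minus_def minus_add a_comm)
  qed
  then show ?thesis ..
qed

lemma cut_value_add:
  assumes M: "proper_cone M" and x: "x \<in> carrier A" and y: "y \<in> carrier A"
    and v: "cut_value M x v" and w: "cut_value M y w"
  shows "cut_value M (x \<oplus> y) (v + w)"
proof -
  have sc: "complex_of_real t \<odot> \<one> \<in> carrier A" for t by simp
  show ?thesis
    unfolding cut_value_def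
  proof (intro conjI allI impI)
    fix t assume t: "t < v + w"
    \<comment> \<open>\<open>s\<close> shares the slack \<open>v + w - t\<close> equally between
      \<open>x\<close> and \<open>y\<close>.\<close>
    define s where "s = v - (v + w - t) / 2"
    have "s < v" "t - s < w" using t by (simp_all add: s_def field_simps)
    then have "(x \<ominus> complex_of_real s \<odot> \<one>) \<oplus> (y \<ominus> complex_of_real (t - s) \<odot> \<one>) \<in> M"
      using v w by (intro proper_coneD(4)[OF M]) (auto simp: cut_value_def)
    also have "(x \<ominus> complex_of_real s \<odot> \<one>) \<oplus> (y \<ominus> complex_of_real (t - s) \<odot> \<one>)
        = (x \<ominus> complex_of_real s \<odot> \<one>) \<oplus> (y \<ominus> (complex_of_real t \<odot> \<one> \<ominus> complex_of_real s \<odot> \<one>))"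
      by (simp add: smult_diff_left)
    also have "\<dots> = (x \<oplus> y) \<ominus> complex_of_real t \<odot> \<one>"
      using x y sc[of s] sc[of t] by algebra
    finally show "(x \<oplus> y) \<ominus> complex_of_real t \<odot> \<one> \<in> M" .
  next
    fix t assume t: "v + w < t"
    define s where "s = v - (v + w - t) / 2"
    have "v < s" "w < t - s" using t by (simp_all add: s_def field_simps)
    then have "(complex_of_real s \<odot> \<one> \<ominus> x) \<oplus> (complex_of_real (t - s) \<odot> \<one> \<ominus> y) \<in> M"
      using v w by (intro proper_coneD(4)[OF M]) (auto simp: cut_value_def)
    also have "(complex_of_real s \<odot> \<one> \<ominus> x) \<oplus> (complex_of_real (t - s) \<odot> \<one> \<ominus> y)
        = (complex_of_real s \<odot> \<one> \<ominus> x) \<oplus> ((complex_of_real t \<odot> \<one> \<ominus> complex_of_real s \<odot> \<one>) \<ominus> y)"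
      by (simp add: smult_diff_left)
    also have "\<dots> = complex_of_real t \<odot> \<one> \<ominus> (x \<oplus> y)"
      using x y sc[of s] sc[of t] by algebra
    finally show "complex_of_real t \<odot> \<one> \<ominus> (x \<oplus> y) \<in> M" .
  qed
qed

lemma cut_value_uminus:
  assumes x: "x \<in> carrier A" and v: "cut_value M x v" shows "cut_value M (\<ominus> x) (- v)"
  unfolding cut_value_def
proof (intro conjI allI impI)
  fix t assume "t < - v"
  then have "complex_of_real (- t) \<odot> \<one> \<ominus> x \<in> M" by (intro cut_valueD[OF v]) simp
  then show "\<ominus> x \<ominus> complex_of_real t \<odot> \<one> \<in> M"
    using x by (simp add: smult_minus_left a_minus_def a_comm)
next
  fix t assume "- v < t"
  then have "x \<ominus> complex_of_real (- t) \<odot> \<one> \<in> M" by (intro cut_valueD[OF v]) simp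
  then show "complex_of_real t \<odot> \<one> \<ominus> (\<ominus> x) \<in> M"
    using x by (simp add: smult_minus_left a_minus_def a_comm)
qed

lemma cut_value_pos_smult:
  assumes M: "proper_cone M" and x: "x \<in> carrier A" and v: "cut_value M x v" and r: "0 < r"
  shows "cut_value M (complex_of_real r \<odot> x) (r * v)"
  unfolding cut_value_def
proof (intro conjI allI impI)
  fix t assume "t < r * v"
  then have "complex_of_real r \<odot> (x \<ominus> complex_of_real (t / r) \<odot> \<one>) \<in> M"
    using r by (intro proper_coneD(5)[OF M] cut_valueD[OF v]) (auto simp: field_simps)
  then show "complex_of_real r \<odot> x \<ominus> complex_of_real t \<odot> \<one> \<in> M"
    using x r by (simp add: smult_diff_right)
next
  fix t assume "r * v < t"
  then have "complex_of_real r \<odot> (complex_of_real (t / r) \<odot> \<one> \<ominus> x) \<in> M"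
    using r by (intro proper_coneD(5)[OF M] cut_valueD[OF v]) (auto simp: field_simps)
  then show "complex_of_real t \<odot> \<one> \<ominus> complex_of_real r \<odot> x \<in> M"
    using x r by (simp add: smult_diff_right)
qed

lemma cut_value_scalar:
  assumes M: "proper_cone M" shows "cut_value M (complex_of_real r \<odot> \<one>) r"
  unfolding cut_value_def
  by (auto simp flip: smult_diff_left of_real_diff intro!: proper_coneD(1)[OF M] scalar_pos_iff[THEN iffD2])

lemma cut_value_smult:
  assumes M: "proper_cone M" and x: "x \<in> carrier A" and v: "cut_value M x v"
  shows "cut_value M (complex_of_real r \<odot> x) (r * v)"
proof (cases r "0 :: real" rule: linorder_cases)
  case less
  then have "cut_value M (\<ominus> (complex_of_real (- r) \<odot> x)) (- (- r * v))"
    using x by (intro cut_value_uminus cut_value_pos_smult[OF M x v]) auto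
  then show ?thesis using x by (simp add: smult_minus_left)
next
  case equal
  then show ?thesis using cut_value_scalar[OF M, of 0] x by simp
next
  case greater
  then show ?thesis by (rule cut_value_pos_smult[OF M x v])
qed

lemma cut_value_nonneg:
  assumes M: "proper_cone M" and x: "x \<in> M" and v: "cut_value M x v"
  shows "0 \<le> v"
proof (rule field_le_epsilon)
  fix e :: real assume "e > 0"
  then have "complex_of_real (v + e) \<odot> \<one> \<ominus> x \<in> M" by (intro cut_valueD[OF v]) simp
  then have "(complex_of_real (v + e) \<odot> \<one> \<ominus> x) \<oplus> x \<in> M" using x by (rule proper_coneD(4)[OF M])
  also have "(complex_of_real (v + e) \<odot> \<one> \<ominus> x) \<oplus> x = complex_of_real (v + e) \<odot> \<one>"
    using proper_coneD(3)[OF M x] smult_in_carrier[OF one_closed, of "complex_of_real (v + e)"] by algebra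
  finally show "0 \<le> v + e" by (rule proper_cone_scalar[OF M])
qed

section \<open>From a total cone to a state\<close>

lemma re_part_of_sa: "h \<in> sa A \<Longrightarrow> re_part h = h"
  by (simp add: re_part_def sa_iff flip: two_smult)

lemma im_part_of_sa: "h \<in> sa A \<Longrightarrow> im_part h = \<zero>"
  by (simp add: im_part_def sa_iff diff_eq_0[THEN iffD2])

lemma re_part_add: "\<lbrakk>a \<in> carrier A; b \<in> carrier A\<rbrakk> \<Longrightarrow> re_part (a \<oplus> b) = re_part a \<oplus> re_part b"
  and im_part_add: "\<lbrakk>a \<in> carrier A; b \<in> carrier A\<rbrakk> \<Longrightarrow> im_part (a \<oplus> b) = im_part a \<oplus> im_part b"
  by (simp_all add: re_part_def im_part_def smult_add_right smult_minus_right minus_add a_minus_def a_ac)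

lemma re_part_smult: "a \<in> carrier A \<Longrightarrow> re_part (complex_of_real r \<odot> a) = complex_of_real r \<odot> re_part a"
  and im_part_smult: "a \<in> carrier A \<Longrightarrow> im_part (complex_of_real r \<odot> a) = complex_of_real r \<odot> im_part a"
  by (simp_all add: re_part_def im_part_def smult_add_right smult_diff_right mult.commute)

lemma re_part_ii: "a \<in> carrier A \<Longrightarrow> re_part (\<i> \<odot> a) = \<ominus> im_part a"
  and im_part_ii: "a \<in> carrier A \<Longrightarrow> im_part (\<i> \<odot> a) = re_part a"
  by (simp_all add: re_part_def im_part_def smult_add_right smult_minus_right smult_minus_left
      minus_add a_minus_def)

text \<open>The cut values form a real linear functional on \<open>sa A\<close>, which is
  complexified through real and imaginary parts. Positivity as a state is where
  \<open>adj_mult_pos\<close> is needed.\<close>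

lemma ex_state_of_total_cone:
  assumes M: "proper_cone M" and tot: "\<And>x. x \<in> sa A \<Longrightarrow> x \<in> M \<or> \<ominus> x \<in> M"
  obtains \<phi> where "\<phi> \<in> states A" "\<And>x. x \<in> M \<Longrightarrow> 0 \<le> Re (\<phi> x)"
proof -
  define f where "f x = (THE v. cut_value M x v)" for x
  have f: "f x = v" if "cut_value M x v" "x \<in> carrier A" for x v
    unfolding f_def using cut_value_unique[OF M that(2)] that by blast
  have cv: "cut_value M x (f x)" if "x \<in> sa A" for x
    using ex_cut_value[OF M tot that] f sa_carrier[OF that] by blast
  have f_add: "f (x \<oplus> y) = f x + f y" if "x \<in> sa A" "y \<in> sa A" for x y
    using that by (intro f cut_value_add[OF M] cv) (auto simp: sa_carrier)
  have f_smult: "f (complex_of_real r \<odot> x) = r * f x" if "x \<in> sa A" for r x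
    using that by (intro f cut_value_smult[OF M] cv) (auto simp: sa_carrier)
  have f_uminus: "f (\<ominus> x) = - f x" if "x \<in> sa A" for x
    using that by (intro f cut_value_uminus cv) (auto simp: sa_carrier)
  have f_one: "f \<one> = 1" using cut_value_scalar[OF M, of 1] by (intro f) auto
  have f_zero: "f \<zero> = 0" using cut_value_scalar[OF M, of 0] by (intro f) auto
  have f_nonneg: "0 \<le> f x" if "x \<in> M" for x
    using cut_value_nonneg[OF M that cv] proper_coneD(2)[OF M that] .
  define \<phi> where "\<phi> = restrict (\<lambda>a. Complex (f (re_part a)) (f (im_part a))) (carrier A)"
  have \<phi>: "\<phi> a = Complex (f (re_part a)) (f (im_part a))" if "a \<in> carrier A" for a
    using that by (simp add: \<phi>_def)
  have \<phi>_sa: "\<phi> h = complex_of_real (f h)" if "h \<in> sa A" for h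
    using that by (simp add: \<phi> sa_carrier re_part_of_sa im_part_of_sa f_zero complex_eq_iff)
  have \<phi>_add: "\<phi> (a \<oplus> b) = \<phi> a + \<phi> b" if "a \<in> carrier A" "b \<in> carrier A" for a b
    using that by (simp add: \<phi> re_part_add im_part_add f_add complex_eq_iff)
  have \<phi>_real: "\<phi> (complex_of_real r \<odot> a) = complex_of_real r * \<phi> a" if "a \<in> carrier A" for r a
    using that by (simp add: \<phi> re_part_smult im_part_smult f_smult complex_eq_iff)
  have \<phi>_ii: "\<phi> (\<i> \<odot> a) = \<i> * \<phi> a" if "a \<in> carrier A" for a
    using that by (simp add: \<phi> re_part_ii im_part_ii f_uminus complex_eq_iff)
  have \<phi>_smult: "\<phi> (c \<odot> a) = c * \<phi> a" if a: "a \<in> carrier A" for c a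
  proof -
    have "c \<odot> a = (complex_of_real (Re c) + \<i> * complex_of_real (Im c)) \<odot> a"
      by (simp flip: complex_eq)
    also have "\<dots> = complex_of_real (Re c) \<odot> a \<oplus> \<i> \<odot> (complex_of_real (Im c) \<odot> a)"
      using a by (simp add: smult_add_left)
    finally have "\<phi> (c \<odot> a) = (complex_of_real (Re c) + \<i> * complex_of_real (Im c)) * \<phi> a"
      using a by (simp only: \<phi>_add \<phi>_ii \<phi>_real smult_in_carrier) (simp add: algebra_simps)
    then show ?thesis by (simp flip: complex_eq)
  qed
  have "\<phi> (adj A a \<otimes> a) \<in> \<real>\<^sub>\<ge>\<^sub>0" if a: "a \<in> carrier A" for a
    using f_nonneg[OF proper_coneD(1)[OF M adj_mult_pos[OF a]]]
    by (simp add: \<phi>_sa sa_adj_mult a)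
  then have "\<phi> \<in> states A"
    unfolding states_def using \<phi>_add \<phi>_smult \<phi>_sa[OF sa_one] f_one by (simp add: \<phi>_def)
  moreover have "0 \<le> Re (\<phi> x)" if "x \<in> M" for x
    using f_nonneg[OF that] proper_coneD(2)[OF M that] by (simp add: \<phi>_sa)
  ultimately show ?thesis using that by blast
qed

section \<open>Enough states to control the norm\<close>

lemma state_add: "\<lbrakk>\<phi> \<in> states A; a \<in> carrier A; b \<in> carrier A\<rbrakk> \<Longrightarrow> \<phi> (a \<oplus> b) = \<phi> a + \<phi> b"
  and state_smult: "\<lbrakk>\<phi> \<in> states A; a \<in> carrier A\<rbrakk> \<Longrightarrow> \<phi> (c \<odot> a) = c * \<phi> a"
  and state_adj_mult: "\<lbrakk>\<phi> \<in> states A; a \<in> carrier A\<rbrakk> \<Longrightarrow> \<phi> (adj A a \<otimes> a) \<in> \<real>\<^sub>\<ge>\<^sub>0"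
  and state_one: "\<phi> \<in> states A \<Longrightarrow> \<phi> \<one> = 1"
  by (auto simp: states_def)

lemma state_diff:
  "\<lbrakk>\<phi> \<in> states A; a \<in> carrier A; b \<in> carrier A\<rbrakk> \<Longrightarrow> \<phi> (a \<ominus> b) = \<phi> a - \<phi> b"
  using state_add[of \<phi> a "\<ominus> b"] state_smult[of \<phi> b "-1"] by (simp add: a_minus_def smult_minus_left)

lemma state_scalar: "\<phi> \<in> states A \<Longrightarrow> \<phi> (c \<odot> \<one>) = c"
  by (simp add: state_smult state_one)

text \<open>If \<open>t - h\<close> is not positive, \<open>h - t\<close> can be adjoined to
  \<open>pos\<close>; a state nonnegative on a total cone above the result has value at least
  \<open>t\<close> at \<open>h\<close>.\<close>

lemma ex_state:
  assumes h: "h \<in> sa A" and t: "complex_of_real t \<odot> \<one> \<ominus> h \<notin> pos"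
  shows "\<exists>\<phi>\<in>states A. t \<le> Re (\<phi> h)"
proof -
  let ?x = "h \<ominus> complex_of_real t \<odot> \<one>"
  have hc [simp]: "h \<in> carrier A" using h by (rule sa_carrier)
  have xs: "?x \<in> sa A" using h by simp
  have nx: "\<ominus> ?x \<notin> pos" using t by (simp add: a_minus_def minus_add a_comm)
  obtain K where K: "proper_cone K" "pos \<subseteq> K" "?x \<in> K"
    by (rule proper_cone_extend[OF pos_proper_cone xs nx])
  obtain M where M: "proper_cone M" "K \<subseteq> M" "\<And>x. x \<in> sa A \<Longrightarrow> x \<in> M \<or> \<ominus> x \<in> M"
    by (rule ex_total_proper_cone[OF K(1)]) blast
  obtain \<phi> where \<phi>: "\<phi> \<in> states A" "\<And>x. x \<in> M \<Longrightarrow> 0 \<le> Re (\<phi> x)"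
    by (rule ex_state_of_total_cone[OF M(1,3)]) auto
  have "0 \<le> Re (\<phi> ?x)" using \<phi>(2) K(3) M(2) by blast
  then have "t \<le> Re (\<phi> h)" using \<phi>(1) by (simp add: state_diff state_scalar)
  then show ?thesis using \<phi>(1) by blast
qed

lemma states_nonempty: "states A \<noteq> {}"
proof -
  have "complex_of_real 0 \<odot> \<one> \<ominus> \<one> \<notin> pos"
    using scalar_pos_iff[of "-1"] by (simp add: a_minus_def smult_minus_left)
  then show ?thesis using ex_state[OF sa_one] by blast
qed

text \<open>Strictness of the bound contradicts the conclusion of \<open>ex_state\<close>, so
  \<open>t - h\<close> and \<open>t + h\<close> are both positive. They add up to
  \<open>2 t\<close>, hence \<open>t - h\<close> has norm at most \<open>2 t\<close>, and the
  triangle inequality adds another \<open>t\<close>.\<close>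

lemma nrm_le_of_states:
  assumes h: "h \<in> sa A" and t: "\<And>\<phi>. \<phi> \<in> states A \<Longrightarrow> cmod (\<phi> h) < t"
  shows "nrm A h \<le> 3 * t"
proof -
  have hc [simp]: "h \<in> carrier A" using h by (rule sa_carrier)
  let ?t = "complex_of_real t \<odot> \<one>"
  have t0: "0 < t" using states_nonempty t by (metis ex_in_conv le_less_trans norm_ge_zero)
  have tc: "?t \<in> carrier A" by simp
  have "?t \<ominus> h \<in> pos"
    using ex_state[OF h] t complex_Re_le_cmod by (meson linorder_not_le order_trans)
  moreover have "?t \<oplus> h \<in> pos"
  proof (rule ccontr)
    assume "?t \<oplus> h \<notin> pos"
    then have "?t \<ominus> (\<ominus> h) \<notin> pos" by (simp add: a_minus_def)
    then obtain \<phi> where \<phi>: "\<phi> \<in> states A" "t \<le> Re (\<phi> (\<ominus> h))" using ex_state[of "\<ominus> h"] h by auto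
    have "\<phi> (\<ominus> h) = - \<phi> h" using state_smult[OF \<phi>(1) hc, of "-1"] by (simp add: smult_minus_left)
    then show False using \<phi> t[OF \<phi>(1)] complex_Re_le_cmod[of "- \<phi> h"] by simp
  qed
  moreover have "complex_of_real (2 * t) \<odot> \<one> \<ominus> (?t \<ominus> h) = ?t \<oplus> h"
  proof -
    have "complex_of_real (2 * t) \<odot> \<one> = ?t \<oplus> ?t" using two_smult[OF tc] by simp
    then show ?thesis using tc hc by (simp only:) algebra
  qed
  ultimately have "nrm A (?t \<ominus> h) \<le> 2 * t" using nrm_le_of_pos by simp
  moreover have "h = ?t \<ominus> (?t \<ominus> h)" using tc hc by algebra
  then have "nrm A h \<le> nrm A ?t + nrm A (?t \<ominus> h)" using nrm_diff[of ?t "?t \<ominus> h"] by simp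
  moreover have "nrm A ?t = t" using t0 by (simp add: nrm_smult)
  ultimately show ?thesis by simp
qed

end


section \<open>Total boundedness\<close>

lemma closedin_Collect_Ball:
  assumes "\<And>i. i \<in> I \<Longrightarrow> closedin T {x \<in> topspace T. P i x}"
  shows "closedin T {x \<in> topspace T. \<forall>i\<in>I. P i x}"
proof -
  have "{x \<in> topspace T. \<forall>i\<in>I. P i x} = \<Inter>(insert (topspace T) ((\<lambda>i. {x \<in> topspace T. P i x}) ` I))"
    by auto
  also have "closedin T \<dots>" using assms by (intro closedin_Inter) auto
  finally show ?thesis .
qed

context unital_cstar_algebra
begin

text \<open>The elements \<open>nrm A h - h\<close> and \<open>nrm A h + h\<close> are squares of
  self-adjoint elements, so a state sends them to nonnegative reals; this carries both reality and
  the bound.\<close>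

lemma state_sa:
  assumes \<phi>: "\<phi> \<in> states A" and h: "h \<in> sa A"
  shows "Im (\<phi> h) = 0" and "cmod (\<phi> h) \<le> nrm A h"
proof -
  have *: "nrm A g - \<phi> g \<in> \<real>\<^sub>\<ge>\<^sub>0" if g: "g \<in> sa A" for g
  proof -
    obtain r where r: "r \<in> pos" "r \<otimes> r = complex_of_real (nrm A g) \<odot> \<one> \<ominus> g"
      using pos_sqrt[OF pos_nrm_diff[OF g order.refl]] by metis
    have "\<phi> (adj A r \<otimes> r) = nrm A g - \<phi> g"
      using pos_sa[OF r(1)] r(2) \<phi> g by (simp add: sa_iff state_diff state_scalar)
    then show ?thesis using state_adj_mult[OF \<phi> pos_carrier[OF r(1)]] by simp
  qed
  have hc: "h \<in> carrier A" using h by (rule sa_carrier)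
  have "\<phi> (\<ominus> h) = - \<phi> h" using state_smult[OF \<phi> hc, of "-1"] hc by (simp add: smult_minus_left)
  then have "nrm A h + \<phi> h \<in> \<real>\<^sub>\<ge>\<^sub>0" using *[of "\<ominus> h"] h hc by simp
  then show "Im (\<phi> h) = 0" "cmod (\<phi> h) \<le> nrm A h"
    using *[OF h] by (auto simp: complex_nonneg_Reals_iff cmod_eq_Re)
qed

lemma state_bound:
  assumes \<phi>: "\<phi> \<in> states A" and a: "a \<in> carrier A"
  shows "cmod (\<phi> a) \<le> 2 * nrm A a"
proof -
  have re: "nrm A (re_part a) \<le> nrm A a" and im: "nrm A (im_part a) \<le> nrm A a"
    using nrm_add[of a "adj A a"] nrm_diff[of a "adj A a"] a
    by (simp_all add: re_part_def im_part_def nrm_smult norm_divide)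
  have "\<phi> a = \<phi> (re_part a) + \<i> * \<phi> (im_part a)"
    by (subst re_im_decomp[OF a]) (use a \<phi> in \<open>simp add: state_add state_smult sa_carrier\<close>)
  then have "cmod (\<phi> a) \<le> cmod (\<phi> (re_part a)) + cmod (\<phi> (im_part a))"
    by (metis norm_triangle_ineq norm_mult norm_ii mult_1)
  also have "\<dots> \<le> nrm A (re_part a) + nrm A (im_part a)"
    using a by (intro add_mono state_sa(2)[OF \<phi>]) auto
  finally show ?thesis using re im by simp
qed

text \<open>Banach-Alaoglu for states: by \<open>state_bound\<close> they lie in a product of discs,
  compact by Tychonoff, and each defining clause is a closed condition on coordinates.\<close>

lemma compactin_states: "compactin (product_topology (\<lambda>_. euclidean) (carrier A)) (states A)"
proof -
  define T :: "('a \<Rightarrow> complex) topology" where "T = product_topology (\<lambda>_. euclidean) (carrier A)"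
  have topX: "topspace T = extensional (carrier A)" by (simp add: T_def PiE_def)
  have proj: "continuous_map T euclidean (\<lambda>f. f a)" if "a \<in> carrier A" for a
    unfolding T_def using that by (rule continuous_map_product_projection)
  have pre: "closedin T {f \<in> topspace T. g f \<in> S}"
    if "continuous_map T euclidean g" "closed S" for g :: "('a \<Rightarrow> complex) \<Rightarrow> complex" and S
    using closedin_continuous_map_preimage[OF that(1)] that(2) by auto
  have "closedin T {f \<in> topspace T. \<forall>a\<in>carrier A. \<forall>b\<in>carrier A. f (a \<oplus> b) - (f a + f b) \<in> {0}}"
    by (intro closedin_Collect_Ball pre continuous_map_diff continuous_map_add proj) auto
  moreover have "closedin T {f \<in> topspace T. \<forall>c\<in>UNIV. \<forall>a\<in>carrier A. f (c \<odot> a) - c * f a \<in> {0}}"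
    by (intro closedin_Collect_Ball pre continuous_map_diff proj
        continuous_map_compose[OF proj, of _ euclidean "\<lambda>z. _ * z", unfolded o_def])
      (auto intro!: continuous_intros)
  moreover have "closedin T {f \<in> topspace T. \<forall>a\<in>carrier A. f (adj A a \<otimes> a) \<in> \<real>\<^sub>\<ge>\<^sub>0}"
    by (intro closedin_Collect_Ball pre proj closed_nonneg_Reals_complex) auto
  moreover have "closedin T {f \<in> topspace T. f \<one> \<in> {1}}"
    by (intro pre proj) auto
  ultimately have "closedin T
     ({f \<in> topspace T. \<forall>a\<in>carrier A. \<forall>b\<in>carrier A. f (a \<oplus> b) - (f a + f b) \<in> {0}} \<inter>
      {f \<in> topspace T. \<forall>c\<in>UNIV. \<forall>a\<in>carrier A. f (c \<odot> a) - c * f a \<in> {0}} \<inter>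
      {f \<in> topspace T. \<forall>a\<in>carrier A. f (adj A a \<otimes> a) \<in> \<real>\<^sub>\<ge>\<^sub>0} \<inter> {f \<in> topspace T. f \<one> \<in> {1}})"
    by (intro closedin_Int)
  also have "\<dots> = states A" unfolding topX by (auto simp: states_def)
  finally have closed: "closedin T (states A)" .
  have "compactin T (PiE (carrier A) (\<lambda>a. cball 0 (2 * nrm A a)))"
    unfolding T_def compactin_PiE by auto
  moreover have "states A \<subseteq> PiE (carrier A) (\<lambda>a. cball 0 (2 * nrm A a))"
    using state_bound by (auto simp: PiE_def states_def)
  ultimately show ?thesis using closed closed_compactin unfolding T_def by blast
qed

section \<open>Finite nets of states and finite classes of elements\<close>

lemma finite_mk_dist_net:
  assumes L: "metrizes_weak_star A L" and \<delta>: "\<delta> > 0"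
  shows "\<exists>K. finite K \<and> K \<subseteq> states A \<and> (\<forall>\<phi>\<in>states A. \<exists>\<psi>\<in>K. mk_dist A L \<phi> \<psi> \<le> ennreal \<delta>)"
proof -
  let ?d = "\<lambda>\<phi> \<psi>. enn2real (mk_dist A L \<phi> \<psi>)"
  interpret MK: Metric_space "states A" ?d using L by (simp add: metrizes_weak_star_def)
  have top: "MK.mtopology = weak_star_topology A" using L by (simp add: metrizes_weak_star_def)
  have "compactin MK.mtopology (states A)"
    unfolding top weak_star_topology_def by (simp add: compactin_subtopology compactin_states)
  then have "MK.mtotally_bounded (states A)" by (rule MK.compactin_imp_mtotally_bounded)
  then obtain K where K: "finite K" "K \<subseteq> states A" "states A \<subseteq> (\<Union>\<psi>\<in>K. MK.mball \<psi> \<delta>)"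
    using \<delta> unfolding MK.mtotally_bounded_def by metis
  have "mk_dist A L \<phi> \<psi> \<le> ennreal \<delta>" if "\<phi> \<in> MK.mball \<psi> \<delta>" for \<phi> \<psi>
  proof -
    \<comment> \<open>Finiteness is essential to return to \<open>mk_dist\<close>, because
      \<open>enn2real\<close> sends infinity to 0.\<close>
    have "?d \<phi> \<psi> < \<delta>" "mk_dist A L \<phi> \<psi> < \<infinity>"
      using that L by (auto simp: MK.commute metrizes_weak_star_def)
    then show ?thesis by (simp add: enn2real_less_iff less_imp_le)
  qed
  moreover have "\<exists>\<psi>\<in>K. \<phi> \<in> MK.mball \<psi> \<delta>" if "\<phi> \<in> states A" for \<phi>
    using subsetD[OF K(3) that] by simp
  ultimately have "\<forall>\<phi>\<in>states A. \<exists>\<psi>\<in>K. mk_dist A L \<phi> \<psi> \<le> ennreal \<delta>" by metis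
  then show ?thesis using K(1,2) by metis
qed

lemma mk_dist_bound:
  assumes L: "qcms A L" and a: "a \<in> sa A" "L a \<le> ennreal C" and C: "C > 0"
    and \<phi>: "\<phi> \<in> states A" and \<psi>: "\<psi> \<in> states A"
    and \<delta>: "mk_dist A L \<phi> \<psi> \<le> ennreal \<delta>" "\<delta> \<ge> 0"
  shows "cmod (\<phi> a - \<psi> a) \<le> C * \<delta>"
proof -
  let ?a = "complex_of_real (1 / C) \<odot> a"
  have ac: "a \<in> carrier A" using a(1) by (rule sa_carrier)
  have "a \<in> lip_dom A L" using a by (auto simp: lip_dom_def intro: le_less_trans)
  then have "L ?a = ennreal \<bar>1 / C\<bar> * L a" using L unfolding qcms_def by blast
  also have "\<dots> \<le> ennreal \<bar>1 / C\<bar> * ennreal C" using a(2) by (rule mult_left_mono) simp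
  also have "\<dots> = 1" using C by (simp flip: ennreal_mult)
  finally have "?a \<in> lip_ball A L" using a(1) by (simp add: lip_ball_def del: of_real_divide)
  then have "ennreal (cmod (\<phi> ?a - \<psi> ?a)) \<le> mk_dist A L \<phi> \<psi>"
    unfolding mk_dist_def by (rule SUP_upper)
  then have le: "cmod (\<phi> ?a - \<psi> ?a) \<le> \<delta>" using \<delta> by (meson ennreal_le_iff order.trans)
  have eq: "\<phi> ?a - \<psi> ?a = complex_of_real (1 / C) * (\<phi> a - \<psi> a)"
    using ac \<phi> \<psi> by (simp only: state_smult) (simp add: algebra_simps)
  have "1 / C * cmod (\<phi> a - \<psi> a) \<le> \<delta>"
    using le C unfolding eq by (simp add: norm_mult norm_divide)
  then show ?thesis using C by (simp add: field_simps)
qed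

text \<open>\<open>G a\<close> lists the rounded values at \<open>a\<close> of finitely many states, normalised by a fixed state.\<close>

lemma finite_lip_classes:
  assumes L: "qcms A L" and C: "C > 0" and e: "e > 0"
  shows "\<exists>G :: 'a \<Rightarrow> ('a \<Rightarrow> complex) \<Rightarrow> int. finite (G ` {a \<in> sa A. L a \<le> ennreal C}) \<and>
    (\<forall>a\<in>{a \<in> sa A. L a \<le> ennreal C}. \<forall>b\<in>{a \<in> sa A. L a \<le> ennreal C}. G a = G b \<longrightarrow>
      (\<exists>r. nrm A (a \<ominus> (b \<oplus> complex_of_real r \<odot> \<one>)) \<le> e))"
proof -
  let ?S = "{a \<in> sa A. L a \<le> ennreal C}"
  \<comment> \<open>Rounding costs \<open>\<delta>\<close>, moving from a state to the net costs
    \<open>C * \<delta>\<close> for each of \<open>a\<close> and \<open>b\<close>, and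
    \<open>nrm_le_of_states\<close> multiplies by 3.\<close>
  define \<delta> where "\<delta> = e / (3 * (1 + 2 * C))"
  have \<delta>: "\<delta> > 0" using C e by (simp add: \<delta>_def)
  have mw: "metrizes_weak_star A L" using L by (simp add: qcms_def)
  obtain K where K: "finite K" "K \<subseteq> states A"
    and net: "\<And>\<phi>. \<phi> \<in> states A \<Longrightarrow> \<exists>\<psi>\<in>K. mk_dist A L \<phi> \<psi> \<le> ennreal \<delta>"
    using finite_mk_dist_net[OF mw \<delta>] by blast
  obtain \<mu> where \<mu>: "\<mu> \<in> states A" using states_nonempty by blast
  \<comment> \<open>Subtracting \<open>\<mu> a\<close> cancels the scalar part of \<open>a\<close>,
    which is unbounded on \<open>?S\<close>; what remains is at most \<open>D \<psi>\<close>, so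
    only finitely many rounded values occur.\<close>
  define D where "D \<psi> = C * enn2real (mk_dist A L \<psi> \<mu>)" for \<psi>
  define G where "G a = restrict (\<lambda>\<psi>. \<lfloor>Re (\<psi> a - \<mu> a) / \<delta>\<rfloor>) K" for a
  have D: "\<bar>Re (\<psi> a - \<mu> a)\<bar> \<le> D \<psi>" if "a \<in> ?S" "\<psi> \<in> K" for a \<psi>
  proof -
    have \<psi>: "\<psi> \<in> states A" using that K by blast
    have "mk_dist A L \<psi> \<mu> < \<infinity>" using mw \<psi> \<mu> by (simp add: metrizes_weak_star_def)
    then have "cmod (\<psi> a - \<mu> a) \<le> D \<psi>"
      unfolding D_def using that by (intro mk_dist_bound[OF L _ _ C \<psi> \<mu>]) auto
    then show ?thesis using abs_Re_le_cmod order.trans by blast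
  qed
  have "G ` ?S \<subseteq> PiE K (\<lambda>\<psi>. {\<lfloor>- D \<psi> / \<delta>\<rfloor>..\<lfloor>D \<psi> / \<delta>\<rfloor>})"
  proof
    fix g assume "g \<in> G ` ?S"
    then obtain a where a: "a \<in> ?S" "g = G a" by blast
    have "\<lfloor>Re (\<psi> a - \<mu> a) / \<delta>\<rfloor> \<in> {\<lfloor>- D \<psi> / \<delta>\<rfloor>..\<lfloor>D \<psi> / \<delta>\<rfloor>}" if "\<psi> \<in> K" for \<psi>
      using D[OF a(1) that] \<delta> unfolding atLeastAtMost_iff
      by (intro conjI floor_mono divide_right_mono) auto
    then show "g \<in> PiE K (\<lambda>\<psi>. {\<lfloor>- D \<psi> / \<delta>\<rfloor>..\<lfloor>D \<psi> / \<delta>\<rfloor>})" unfolding a(2) G_def by auto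
  qed
  moreover have "finite (PiE K (\<lambda>\<psi>. {\<lfloor>- D \<psi> / \<delta>\<rfloor>..\<lfloor>D \<psi> / \<delta>\<rfloor>}))"
    using K(1) by (intro finite_PiE) auto
  ultimately have fin: "finite (G ` ?S)" by (rule finite_subset)
  have close: "nrm A (a \<ominus> (b \<oplus> complex_of_real (Re (\<mu> a - \<mu> b)) \<odot> \<one>)) \<le> e"
    if a: "a \<in> ?S" and b: "b \<in> ?S" and eq: "G a = G b" for a b
  proof -
    \<comment> \<open>This scalar makes the real part of \<open>\<psi> ?c\<close> the difference of
      the normalised values of \<open>\<psi>\<close> at \<open>a\<close> and \<open>b\<close>, the
      quantities that \<open>G\<close> rounds.\<close>
    let ?r = "Re (\<mu> a - \<mu> b)"
    let ?c = "a \<ominus> (b \<oplus> complex_of_real ?r \<odot> \<one>)"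
    have sab: "a \<in> sa A" "b \<in> sa A" using a b by auto
    have ab: "a \<in> carrier A" "b \<in> carrier A" using sab by (auto simp: sa_carrier)
    have cs: "?c \<in> sa A" by (intro sa_diff sa_add sa_smult sa_one sab)
    have \<phi>c: "\<phi> ?c = \<phi> a - \<phi> b - ?r" if "\<phi> \<in> states A" for \<phi>
      using that ab by (simp add: state_diff state_add state_scalar del: of_real_diff minus_complex.sel)
    have bound: "cmod (\<phi> ?c) < \<delta> * (1 + 2 * C)" if \<phi>: "\<phi> \<in> states A" for \<phi>
    proof -
      obtain \<psi> where \<psi>: "\<psi> \<in> K" "mk_dist A L \<phi> \<psi> \<le> ennreal \<delta>" using net[OF \<phi>] by blast
      have \<psi>s: "\<psi> \<in> states A" using \<psi>(1) K by blast
      have "\<lfloor>Re (\<psi> a - \<mu> a) / \<delta>\<rfloor> = \<lfloor>Re (\<psi> b - \<mu> b) / \<delta>\<rfloor>"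
        using fun_cong[OF eq, of \<psi>] \<psi>(1) by (simp add: G_def)
      then have "\<bar>Re (\<psi> a - \<mu> a) / \<delta> - Re (\<psi> b - \<mu> b) / \<delta>\<bar> < 1" by linarith
      then have "\<bar>Re (\<psi> a - \<mu> a) - Re (\<psi> b - \<mu> b)\<bar> < \<delta>"
        using \<delta> by (simp add: abs_divide flip: diff_divide_distrib)
      then have "\<bar>Re (\<psi> ?c)\<bar> < \<delta>" unfolding \<phi>c[OF \<psi>s] by (simp add: algebra_simps)
      then have 1: "cmod (\<psi> ?c) < \<delta>" using state_sa(1)[OF \<psi>s cs] by (simp add: cmod_eq_Re)
      have split: "\<phi> ?c = \<psi> ?c + ((\<phi> a - \<psi> a) - (\<phi> b - \<psi> b))" 
        unfolding \<phi>c[OF \<phi>] \<phi>c[OF \<psi>s] by simp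
      have "cmod (\<phi> ?c) \<le> cmod (\<psi> ?c) + (cmod (\<phi> a - \<psi> a) + cmod (\<phi> b - \<psi> b))"
        by (subst split, rule norm_triangle_le, rule add_left_mono, rule norm_triangle_ineq4)
      also have "\<dots> < \<delta> + (C * \<delta> + C * \<delta>)"
        using 1 a b \<delta> by (intro add_less_le_mono add_mono mk_dist_bound[OF L _ _ C \<phi> \<psi>s \<psi>(2)]) auto
      finally show ?thesis by (simp add: algebra_simps)
    qed
    have "nrm A ?c \<le> 3 * (\<delta> * (1 + 2 * C))" by (rule nrm_le_of_states[OF cs], erule bound)
    moreover have "3 * (\<delta> * (1 + 2 * C)) = e" using C by (simp add: \<delta>_def field_simps)
    ultimately show ?thesis by simp
  qed
  show ?thesis using fin close by blast
qed

end

section \<open>Total boundedness for the Hausdorff distance\<close>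

lemma lip_ball_add_scalar:
  assumes L: "qcms A L" and b: "b \<in> lip_ball A L"
  shows "b \<oplus>\<^bsub>A\<^esub> complex_of_real r \<odot>\<^bsub>A\<^esub> \<one>\<^bsub>A\<^esub> \<in> lip_ball A L"
proof -
  interpret unital_cstar_algebra A using L by (simp add: qcms_def)
  let ?r = "complex_of_real r \<odot>\<^bsub>A\<^esub> \<one>\<^bsub>A\<^esub>"
  have "?r \<in> {a \<in> lip_dom A L. L a = 0}" using L unfolding qcms_def by blast
  then have r: "?r \<in> lip_dom A L" "L ?r = 0" by auto
  have bd: "b \<in> lip_dom A L" "b \<in> sa A" "L b \<le> 1"
    using b by (auto simp: lip_dom_def lip_ball_def intro: le_less_trans)
  have "L (b \<oplus>\<^bsub>A\<^esub> ?r) \<le> L b + L ?r" using L r bd unfolding qcms_def by blast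
  then show ?thesis using r bd by (auto simp: lip_ball_def intro: order.trans)
qed

lemma hausdorff_le:
  assumes "\<And>s. s \<in> S \<Longrightarrow> \<exists>t\<in>T. d s t \<le> e" "\<And>t. t \<in> T \<Longrightarrow> \<exists>s\<in>S. d s t \<le> e"
  shows "hausdorff d S T \<le> e"
  unfolding hausdorff_def using assms by (intro max.boundedI SUP_least) (meson INF_lower2)+

lemma totally_bounded_haus_lip:
  assumes L: "qcms A L" and C: "C > 0"
    and \<Xi>: "\<And>Lip. Lip \<in> \<Xi> \<Longrightarrow> qcms A Lip"
    and dom: "\<And>Lip a. \<lbrakk>Lip \<in> \<Xi>; a \<in> sa A\<rbrakk> \<Longrightarrow> L a \<le> ennreal C * Lip a"
  shows "totally_bounded_for (haus_lip A) \<Xi>"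
  unfolding totally_bounded_for_def
proof (intro allI impI)
  interpret unital_cstar_algebra A using L by (simp add: qcms_def)
  fix \<epsilon> :: ennreal assume "\<epsilon> > 0"
  \<comment> \<open>The Hausdorff estimate will only give \<open>\<le> e\<close>, so a real
    \<open>e\<close> strictly below \<open>\<epsilon>\<close> is fixed; \<open>\<epsilon>\<close>
    may be infinite.\<close>
  then obtain e where e: "e > 0" "ennreal e < \<epsilon>"
  proof (cases \<epsilon>)
    case (real r)
    then show ?thesis using that[of "r / 2"] \<open>\<epsilon> > 0\<close> by (auto simp: ennreal_less_iff)
  next
    case top
    then show ?thesis using that[of 1] by simp
  qed
  let ?S = "{a \<in> sa A. L a \<le> ennreal C}"
  obtain G :: "'a \<Rightarrow> ('a \<Rightarrow> complex) \<Rightarrow> int" where fin: "finite (G ` ?S)"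
    and G: "\<And>a b. \<lbrakk>a \<in> ?S; b \<in> ?S; G a = G b\<rbrakk>
      \<Longrightarrow> \<exists>r. nrm A (a \<ominus>\<^bsub>A\<^esub> (b \<oplus>\<^bsub>A\<^esub> complex_of_real r \<odot>\<^bsub>A\<^esub> \<one>\<^bsub>A\<^esub>)) \<le> e"
    using finite_lip_classes[OF L C e(1)] by blast
  define E where "E Lip = G ` lip_ball A Lip" for Lip
  have sub: "lip_ball A Lip \<subseteq> ?S" if Lip: "Lip \<in> \<Xi>" for Lip
  proof
    fix a assume a: "a \<in> lip_ball A Lip"
    then have "ennreal C * Lip a \<le> ennreal C * 1" by (intro mult_left_mono) (auto simp: lip_ball_def)
    then show "a \<in> ?S" using a dom[OF Lip, of a] by (auto simp: lip_ball_def)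
  qed
  have "E ` \<Xi> \<subseteq> Pow (G ` ?S)" using sub by (force simp: E_def)
  then have "finite (E ` \<Xi>)" using fin by (meson finite_Pow_iff finite_subset)
  \<comment> \<open>One Lip-norm is kept for each set of classes that occurs, which places the net
    inside \<open>\<Xi>\<close>.\<close>
  then obtain K where K: "K \<subseteq> \<Xi>" "finite K" "E ` \<Xi> = E ` K"
    using finite_subset_image[of "E ` \<Xi>" E \<Xi>] by blast
  have near: "\<exists>b\<in>lip_ball A Lip'. cstar_dist A a b \<le> e"
    if Lip: "Lip \<in> \<Xi>" "Lip' \<in> \<Xi>" "E Lip = E Lip'" and a: "a \<in> lip_ball A Lip" for Lip Lip' a
  proof -
    obtain b where b: "b \<in> lip_ball A Lip'" "G a = G b" using a Lip(3) unfolding E_def by blast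
    obtain r where r: "nrm A (a \<ominus>\<^bsub>A\<^esub> (b \<oplus>\<^bsub>A\<^esub> complex_of_real r \<odot>\<^bsub>A\<^esub> \<one>\<^bsub>A\<^esub>)) \<le> e"
      using G[of a b] a b sub Lip by blast
    have "b \<oplus>\<^bsub>A\<^esub> complex_of_real r \<odot>\<^bsub>A\<^esub> \<one>\<^bsub>A\<^esub> \<in> lip_ball A Lip'"
      using \<Xi> Lip(2) b(1) by (intro lip_ball_add_scalar) auto
    moreover have "a \<in> carrier A" "b \<in> carrier A" using a b by (auto simp: lip_ball_def sa_def)
    ultimately show ?thesis using r by (auto simp: cstar_dist_def intro!: bexI)
  qed
  have "\<exists>Lip'\<in>K. haus_lip A Lip Lip' < \<epsilon>" if Lip: "Lip \<in> \<Xi>" for Lip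
  proof -
    obtain Lip' where Lip': "Lip' \<in> K" "E Lip = E Lip'" using Lip K(3) by blast
    have sym: "cstar_dist A a b = cstar_dist A b a" for a b
      using Metric_space_cstar_dist by (rule Metric_space.commute)
    have "haus_lip A Lip Lip' \<le> ennreal e"
      unfolding haus_lip_def haus_nrm_def
    proof (rule hausdorff_le)
      fix a assume "a \<in> lip_ball A Lip"
      then show "\<exists>b\<in>lip_ball A Lip'. ennreal (cstar_dist A a b) \<le> ennreal e"
        using near[of Lip Lip' a] Lip Lip' K(1) by (blast intro: ennreal_leI)
    next
      fix b assume "b \<in> lip_ball A Lip'"
      then show "\<exists>a\<in>lip_ball A Lip. ennreal (cstar_dist A a b) \<le> ennreal e"
        using near[of Lip' Lip b] Lip Lip' K(1) by (subst sym) (fastforce intro: ennreal_leI)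
    qed
    then show ?thesis using Lip' e(2) le_less_trans by blast
  qed
  then show "\<exists>K. finite K \<and> K \<subseteq> \<Xi> \<and> (\<forall>x\<in>\<Xi>. \<exists>y\<in>K. haus_lip A x y < \<epsilon>)" using K by blast
qed

section \<open>From the Hausdorff distance to the propinquity\<close>

lemma hausdorff_self: "(\<And>x. x \<in> S \<Longrightarrow> d x x = 0) \<Longrightarrow> hausdorff d S S \<le> 0"
  by (rule hausdorff_le) force+

text \<open>The bound comes from the bridge \<open>(A, 1, id, id)\<close>: all states are \<open>1\<close>-level states, so its
  height vanishes and its length is its reach.\<close>

lemma quantum_propinquity_le_haus_lip:
  assumes "quasi_leibniz F A L" "quasi_leibniz F A L'"
  shows "quantum_propinquity F (A, L) (A, L') \<le> haus_lip A L L'"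
proof -
  interpret unital_cstar_algebra A using assms by (simp add: quasi_leibniz_def qcms_def)
  define \<gamma> where "\<gamma> = \<lparr>br_alg = A, br_pivot = \<one>\<^bsub>A\<^esub>, br_left = (\<lambda>a. a), br_right = (\<lambda>a. a)\<rparr>"
  have level: "level_states A \<one>\<^bsub>A\<^esub> = states A" by (auto simp: level_states_def)
  have comp: "(\<lambda>\<phi>. compose (carrier A) \<phi> (\<lambda>a. a)) ` states A = states A"
  proof -
    have "compose (carrier A) \<phi> (\<lambda>a. a) = \<phi>" if "\<phi> \<in> states A" for \<phi>
      using that by (auto simp: states_def compose_def extensional_restrict)
    then show ?thesis by simp
  qed
  have mono: "unital_star_mono A A (\<lambda>a. a)" by (auto simp: unital_star_mono_def ring_hom_def)
  have bridge: "is_bridge A A \<gamma>"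
    using unital_cstar_algebra_axioms states_nonempty mono by (simp add: is_bridge_def \<gamma>_def level)
  have "(\<lambda>a. a \<otimes>\<^bsub>A\<^esub> \<one>\<^bsub>A\<^esub>) ` lip_ball A L = lip_ball A L"
    "(\<lambda>a. \<one>\<^bsub>A\<^esub> \<otimes>\<^bsub>A\<^esub> a) ` lip_ball A L' = lip_ball A L'"
    by (force simp: lip_ball_def sa_carrier)+
  then have reach: "bridge_reach (A, L) (A, L') \<gamma> = haus_lip A L L'"
    by (simp add: bridge_reach_def \<gamma>_def haus_lip_def)
  have mk0: "mk_dist A M \<phi> \<phi> = 0" for M \<phi> by (simp add: mk_dist_def SUP_constant bot_ennreal)
  have "bridge_height (A, L) (A, L') \<gamma> \<le> 0"
    by (simp only: bridge_height_def \<gamma>_def bridge.simps fst_conv snd_conv level comp)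
      (intro max.boundedI hausdorff_self mk0)
  then have length: "bridge_length (A, L) (A, L') \<gamma> = haus_lip A L L'"
    by (simp add: bridge_length_def reach)
  show ?thesis
    unfolding quantum_propinquity_def
  proof (rule SUP_least)
    fix f :: "'a lip_pair \<Rightarrow> 'a lip_pair \<Rightarrow> real" assume "f \<in> propinquity_candidates F"
    then have "ennreal (f (A, L) (A, L')) \<le> bridge_length (A, L) (A, L') \<gamma>"
      using assms bridge by (fastforce simp: propinquity_candidates_def ql_spaces_def)
    then show "ennreal (f (A, L) (A, L')) \<le> haus_lip A L L'" by (simp add: length)
  qed
qed

theorem proposition3p7:
  fixes A :: "'a cstar" and L :: "'a \<Rightarrow> ennreal" and \<Xi> :: "('a \<Rightarrow> ennreal) set"
  assumes "qcms A L" and "lower_semicontinuous_lip A L"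
    and "\<forall>Lip\<in>\<Xi>. qcms A Lip \<and> lower_semicontinuous_lip A Lip"
    and "\<exists>C::real. C > 0 \<and> (\<forall>Lip\<in>\<Xi>. \<forall>a\<in>sa A. L a \<le> ennreal C * Lip a)"
  shows "totally_bounded_for (haus_lip A) \<Xi> \<and>
    (\<forall>F. admissible F \<and> (\<forall>Lip\<in>\<Xi>. quasi_leibniz F A Lip) \<longrightarrow>
      totally_bounded_for (quantum_propinquity F) ((\<lambda>Lip. (A, Lip)) ` \<Xi>))"
proof (intro conjI allI impI)
  obtain C where C: "C > 0" "\<And>Lip a. \<lbrakk>Lip \<in> \<Xi>; a \<in> sa A\<rbrakk> \<Longrightarrow> L a \<le> ennreal C * Lip a"
    using assms(4) by blast
  show haus: "totally_bounded_for (haus_lip A) \<Xi>"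
    using assms(3) by (intro totally_bounded_haus_lip[OF assms(1) C(1)] C(2)) auto
  fix F assume F: "admissible F \<and> (\<forall>Lip\<in>\<Xi>. quasi_leibniz F A Lip)"
  show "totally_bounded_for (quantum_propinquity F) ((\<lambda>Lip. (A, Lip)) ` \<Xi>)"
    unfolding totally_bounded_for_def
  proof (intro allI impI)
    fix \<epsilon> :: ennreal assume "\<epsilon> > 0"
    then obtain K where K: "finite K" "K \<subseteq> \<Xi>"
      and near: "\<And>Lip. Lip \<in> \<Xi> \<Longrightarrow> \<exists>Lip'\<in>K. haus_lip A Lip Lip' < \<epsilon>"
      using haus unfolding totally_bounded_for_def by meson
    \<comment> \<open>Pairing with \<open>A\<close> does not increase distances, so a finite net for
      \<open>haus_lip\<close> maps to one for the propinquity at the same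
      \<open>\<epsilon>\<close>.\<close>
    have "\<exists>Lip'\<in>K. quantum_propinquity F (A, Lip) (A, Lip') < \<epsilon>" if Lip: "Lip \<in> \<Xi>" for Lip
    proof -
      obtain Lip' where Lip': "Lip' \<in> K" "haus_lip A Lip Lip' < \<epsilon>" using near[OF Lip] by blast
      then have "quantum_propinquity F (A, Lip) (A, Lip') \<le> haus_lip A Lip Lip'"
        using F Lip K(2) by (intro quantum_propinquity_le_haus_lip) auto
      then show ?thesis using Lip' le_less_trans by blast
    qed
    then show "\<exists>M. finite M \<and> M \<subseteq> (\<lambda>Lip. (A, Lip)) ` \<Xi> \<and>
        (\<forall>x\<in>(\<lambda>Lip. (A, Lip)) ` \<Xi>. \<exists>y\<in>M. quantum_propinquity F x y < \<epsilon>)"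
      using K by (intro exI[of _ "(\<lambda>Lip. (A, Lip)) ` K"]) auto
  qed
qed

end
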